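(* Let $M$ be a matroid of rank $d+1$ on $E=\{1,\ldots,n+1\}$ and let $\operatorname{Vol}_M\in\mathbb{R}[x_F]_{F\in\mathcal{L}^{nt}(M)}$ be its mixed volume. For each $i\in E$ choose a vector $v_i\in\mathbb{R}^{d-1}$ such that $\sum_{i\in E}v_i=0$, and for $F\subseteq E$ put $v_F=\sum_{i\in F}v_i$. For a maximal chain of nontrivial flats $\mathcal{F}: F_1<F_2<\cdots<F_d$ (equivalently a maximal cone $\sigma=\sigma_{\mathcal F}$ of the Bergman fan), let $\hat A_\sigma$ be the $d\times d$ matrix whose first row is $(x_{F_1},\ldots,x_{F_d})$ and whose remaining $d-1$ rows form the $(d-1)\times d$ matrix with columns $v_{F_1},\ldots,v_{F_d}$. Write $\det\hat A_\sigma=a_1x_{F_1}+\cdots+a_dx_{F_d}$ and $c_\sigma=d!\,a_1a_2\cdots a_d$. Assume the $v_i$ are chosen generally so that $c_\sigma\neq 0$ for all $\sigma$. Then \[\operatorname{Vol}_M=\sum_{\sigma}\frac{(\det\hat A_\sigma)^d}{c_\sigma},\] the sum running over all maximal chains $\mathcal F$ in $\mathcal{L}^{nt}(M)$. In particular the right-hand side does not depend on the choice of the $v_i$.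
   Context: $\mathcal{L}(M)$ is the lattice of flats of $M$, with minimal flat $\emptyset$ and maximal flat $E$; $\mathcal{L}^{nt}(M)=\mathcal{L}(M)\setminus\{\emptyset,E\}$ is the set of nontrivial flats. The Bergman fan $\Delta_M$ is the simplicial fan in $\mathbb{R}^E/\mathbb{R}e_E\cong\mathbb{R}^n$ (where $e_1,\ldots,e_{n+1}$ is the standard basis and $e_F=\sum_{i\in F}e_i$) with a ray $\rho_F$ generated by the image of $e_F$ for each $F\in\mathcal{L}^{nt}(M)$ and a simplicial cone with rays $\rho_{F_1},\ldots,\rho_{F_m}$ for each chain $F_1<\cdots<F_m$ in $\mathcal{L}^{nt}(M)$; it has dimension $d$. The Chow ring is $\operatorname{CH}(M)=\mathbb{R}[\partial_F]_{F\in\mathcal{L}^{nt}(M)}/(I+J)$, where $I$ is generated by the products $\partial_F\partial_G$ with $F,G$ incomparable, and $J$ is generated by the pullbacks of global linear functions on $\mathbb{R}^E/\mathbb{R}e_E$, i.e. by $\sum_{F}(\sum_{a\in F}c_a)\partial_F$ for all $(c_a)\in\mathbb{R}^E$ with $\sum_a c_a=0$. The degree map $\deg:\operatorname{CH}^d(M)\to\mathbb{R}$ is the linear isomorphism with $\deg(\partial_{F_1}\cdots\partial_{F_d})=1$ for every maximal chain $F_1<\cdots<F_d$ of nontrivial flats. The mixed volume $\operatorname{Vol}_M$ is the unique homogeneous degree $d$ polynomial in variables $x_F$ ($F\in\mathcal{L}^{nt}(M)$) such that for every homogeneous degree $d$ polynomial $f(\partial_F)$, applying $f$ with $\partial_F=\partial/\partial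 x_F$ to $\operatorname{Vol}_M$ gives $\deg$ of the class of $f$ in $\operatorname{CH}^d(M)$. *)

theory Defs
  imports
    "HOL-Library.Poly_Mapping"
    "HOL-Library.FuncSet"
    "HOL-Algebra.QuotRing"
    "Jordan_Normal_Form.Determinant"
begin

section \<open>Matroids and flats\<close>

locale matroid =
  fixes E :: "'a set" and indep :: "'a set \<Rightarrow> bool"
  assumes finite_ground: "finite E"
    and indep_subset_ground: "indep X \<Longrightarrow> X \<subseteq> E"
    and indep_empty: "indep {}"
    and indep_subset: "indep X \<Longrightarrow> Y \<subseteq> X \<Longrightarrow> indep Y"
    and augment: "indep X \<Longrightarrow> indep Y \<Longrightarrow> card X < card Y \<Longrightarrow>
      \<exists>y\<in>Y - X. indep (insert y X)"

definition rank_of :: "('a set \<Rightarrow> bool) \<Rightarrow> 'a set \<Rightarrow> nat" where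
  "rank_of indep A = Max (card ` {X. X \<subseteq> A \<and> indep X})"

definition matroid_closure :: "'a set \<Rightarrow> ('a set \<Rightarrow> bool) \<Rightarrow> 'a set \<Rightarrow> 'a set" where
  "matroid_closure E indep A = {x\<in>E. rank_of indep (insert x A) = rank_of indep A}"

definition flats :: "'a set \<Rightarrow> ('a set \<Rightarrow> bool) \<Rightarrow> 'a set set" where
  "flats E indep = {F. F \<subseteq> E \<and> matroid_closure E indep F = F}"

definition nontrivial_flats :: "'a set \<Rightarrow> ('a set \<Rightarrow> bool) \<Rightarrow> 'a set set" where
  "nontrivial_flats E indep = flats E indep - {{}, E}"

text \<open>Maximal chains of nontrivial flats, each listed in increasing order. They are exactly
  the maximal cones of the Bergman fan.\<close>

definition maximal_chains :: "'a set \<Rightarrow> ('a set \<Rightarrow> bool) \<Rightarrow> 'a set list set" where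
  "maximal_chains E indep =
     {Fs. sorted_wrt (\<subset>) Fs \<and> subset.maxchain (nontrivial_flats E indep) (set Fs)}"


section \<open>Real polynomials in variables indexed by a type\<close>

text \<open>A monomial is a finitely supported exponent function; multiplication is convolution.\<close>

type_synonym 'x rpoly = "('x \<Rightarrow>\<^sub>0 nat) \<Rightarrow>\<^sub>0 real"

definition PVar :: "'x \<Rightarrow> 'x rpoly" where
  "PVar x = Poly_Mapping.single (Poly_Mapping.single x 1) 1"

definition PConst :: "real \<Rightarrow> 'x rpoly" where
  "PConst c = Poly_Mapping.single 0 c"

definition polys_in :: "'x set \<Rightarrow> 'x rpoly set" where
  "polys_in V = {p. \<forall>m\<in>Poly_Mapping.keys p. Poly_Mapping.keys m \<subseteq> V}"

definition homogeneous :: "nat \<Rightarrow> 'x rpoly \<Rightarrow> bool" where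
  "homogeneous k p \<longleftrightarrow>
     (\<forall>m\<in>Poly_Mapping.keys p. (\<Sum>x\<in>Poly_Mapping.keys m. Poly_Mapping.lookup m x) = k)"

definition poly_ring :: "'x set \<Rightarrow> 'x rpoly ring" where
  "poly_ring V =
     \<lparr>carrier = polys_in V, monoid.mult = (*), one = 1, ring.zero = 0, ring.add = (+)\<rparr>"

text \<open>Exponents are subtracted with truncation at 0, but a term in which this matters has the
  coefficient \<open>lookup m x = 0\<close>.\<close>

definition partial_diff :: "'x \<Rightarrow> 'x rpoly \<Rightarrow> 'x rpoly" where
  "partial_diff x p =
     (\<Sum>m\<in>Poly_Mapping.keys p. Poly_Mapping.single (m - Poly_Mapping.single x 1)
       (real (Poly_Mapping.lookup m x) * Poly_Mapping.lookup p m))"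

text \<open>The fold composes the operators \<open>(\<partial>/\<partial>x)\<^sup>k\<close>, where \<open>k = lookup m x\<close>, over the variables
  \<open>x\<close> occurring in \<open>m\<close>; these operators commute.\<close>

definition monom_diff :: "('x \<Rightarrow>\<^sub>0 nat) \<Rightarrow> 'x rpoly \<Rightarrow> 'x rpoly" where
  "monom_diff m p =
     Finite_Set.fold (\<lambda>x q. (partial_diff x ^^ Poly_Mapping.lookup m x) q) p (Poly_Mapping.keys m)"

definition apply_diff :: "'x rpoly \<Rightarrow> 'x rpoly \<Rightarrow> 'x rpoly" where
  "apply_diff f p = (\<Sum>m\<in>Poly_Mapping.keys f. PConst (Poly_Mapping.lookup f m) * monom_diff m p)"


section \<open>The Chow ring, the degree map and the mixed volume\<close>

definition flat_poly_ring :: "'a set \<Rightarrow> ('a set \<Rightarrow> bool) \<Rightarrow> 'a set rpoly ring" where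
  "flat_poly_ring E indep = poly_ring (nontrivial_flats E indep)"

definition incomparable_gens :: "'a set \<Rightarrow> ('a set \<Rightarrow> bool) \<Rightarrow> 'a set rpoly set" where
  "incomparable_gens E indep =
     {PVar F * PVar G | F G. F \<in> nontrivial_flats E indep \<and> G \<in> nontrivial_flats E indep
                              \<and> \<not> F \<subseteq> G \<and> \<not> G \<subseteq> F}"

definition linear_gens :: "'a set \<Rightarrow> ('a set \<Rightarrow> bool) \<Rightarrow> 'a set rpoly set" where
  "linear_gens E indep =
     {(\<Sum>F\<in>nontrivial_flats E indep. PConst (\<Sum>a\<in>F. c a) * PVar F) | c. (\<Sum>a\<in>E. c a) = 0}"

definition chow_ideal :: "'a set \<Rightarrow> ('a set \<Rightarrow> bool) \<Rightarrow> 'a set rpoly set" where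
  "chow_ideal E indep =
     genideal (flat_poly_ring E indep) (incomparable_gens E indep)
     <+>\<^bsub>flat_poly_ring E indep\<^esub>
     genideal (flat_poly_ring E indep) (linear_gens E indep)"

definition chow_ring :: "'a set \<Rightarrow> ('a set \<Rightarrow> bool) \<Rightarrow> 'a set rpoly set ring" where
  "chow_ring E indep = flat_poly_ring E indep Quot chow_ideal E indep"

definition chow_class :: "'a set \<Rightarrow> ('a set \<Rightarrow> bool) \<Rightarrow> 'a set rpoly \<Rightarrow> 'a set rpoly set" where
  "chow_class E indep p = chow_ideal E indep +>\<^bsub>flat_poly_ring E indep\<^esub> p"

definition chow_graded :: "'a set \<Rightarrow> ('a set \<Rightarrow> bool) \<Rightarrow> nat \<Rightarrow> 'a set rpoly set set" where
  "chow_graded E indep k =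
     chow_class E indep ` {p \<in> polys_in (nontrivial_flats E indep). homogeneous k p}"

text \<open>The scalar multiple of a class \<open>X\<close> by \<open>r\<close> is the product with the class of the constant
  \<open>r\<close>. Extensionality fixes the values outside the graded piece, so that the map is unique as a
  HOL function.\<close>

definition is_degree_map ::
  "'a set \<Rightarrow> ('a set \<Rightarrow> bool) \<Rightarrow> nat \<Rightarrow> ('a set rpoly set \<Rightarrow> real) \<Rightarrow> bool" where
  "is_degree_map E indep d g \<longleftrightarrow>
     g \<in> extensional (chow_graded E indep d) \<and>
     (\<forall>X\<in>chow_graded E indep d. \<forall>Y\<in>chow_graded E indep d.
        g (X \<oplus>\<^bsub>chow_ring E indep\<^esub> Y) = g X + g Y) \<and>
     (\<forall>r. \<forall>X\<in>chow_graded E indep d.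
        g (chow_class E indep (PConst r) \<otimes>\<^bsub>chow_ring E indep\<^esub> X) = r * g X) \<and>
     bij_betw g (chow_graded E indep d) UNIV \<and>
     (\<forall>Fs\<in>maximal_chains E indep. g (chow_class E indep (\<Prod>F\<leftarrow>Fs. PVar F)) = 1)"

definition chow_deg :: "'a set \<Rightarrow> ('a set \<Rightarrow> bool) \<Rightarrow> nat \<Rightarrow> 'a set rpoly set \<Rightarrow> real" where
  "chow_deg E indep d = (THE g. is_degree_map E indep d g)"

definition is_mixed_volume ::
  "'a set \<Rightarrow> ('a set \<Rightarrow> bool) \<Rightarrow> nat \<Rightarrow> 'a set rpoly \<Rightarrow> bool" where
  "is_mixed_volume E indep d V \<longleftrightarrow>
     V \<in> polys_in (nontrivial_flats E indep) \<and> homogeneous d V \<and>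
     (\<forall>f \<in> polys_in (nontrivial_flats E indep). homogeneous d f \<longrightarrow>
        apply_diff f V = PConst (chow_deg E indep d (chow_class E indep f)))"

definition mixed_volume :: "'a set \<Rightarrow> ('a set \<Rightarrow> bool) \<Rightarrow> nat \<Rightarrow> 'a set rpoly" where
  "mixed_volume E indep d = (THE V. is_mixed_volume E indep d V)"


section \<open>The determinants attached to maximal chains\<close>

definition vec_sum :: "nat \<Rightarrow> ('a \<Rightarrow> real vec) \<Rightarrow> 'a set \<Rightarrow> real vec" where
  "vec_sum m v F = finsum_vec TYPE(real) m v F"

text \<open>Rows and columns are numbered from 0, so row \<open>r\<close> with \<open>r > 0\<close> holds coordinate \<open>r - 1\<close> of
  the vectors \<open>v\<^sub>F\<close>.\<close>

definition hat_matrix :: "nat \<Rightarrow> ('a \<Rightarrow> real vec) \<Rightarrow> 'a set list \<Rightarrow> 'a set rpoly mat" where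
  "hat_matrix d v Fs = mat d d (\<lambda>(r, j).
     if r = 0 then PVar (Fs ! j) else PConst (vec_sum (d - 1) v (Fs ! j) $ (r - 1)))"

definition chain_coeff :: "nat \<Rightarrow> ('a \<Rightarrow> real vec) \<Rightarrow> 'a set list \<Rightarrow> nat \<Rightarrow> real" where
  "chain_coeff d v Fs j = Poly_Mapping.lookup (det (hat_matrix d v Fs)) (Poly_Mapping.single (Fs ! j) 1)"

definition chain_const :: "nat \<Rightarrow> ('a \<Rightarrow> real vec) \<Rightarrow> 'a set list \<Rightarrow> real" where
  "chain_const d v Fs = fact d * (\<Prod>j<d. chain_coeff d v Fs j)"

definition general_vectors ::
  "'a set \<Rightarrow> ('a set \<Rightarrow> bool) \<Rightarrow> nat \<Rightarrow> ('a \<Rightarrow> real vec) \<Rightarrow> bool" where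
  "general_vectors E indep d v \<longleftrightarrow>
     (\<forall>i\<in>E. v i \<in> carrier_vec (d - 1)) \<and>
     vec_sum (d - 1) v E = 0\<^sub>v (d - 1) \<and>
     (\<forall>Fs\<in>maximal_chains E indep. chain_const d v Fs \<noteq> 0)"

definition determinantal_sum ::
  "'a set \<Rightarrow> ('a set \<Rightarrow> bool) \<Rightarrow> nat \<Rightarrow> ('a \<Rightarrow> real vec) \<Rightarrow> 'a set rpoly" where
  "determinantal_sum E indep d v =
     (\<Sum>Fs\<in>maximal_chains E indep.
        PConst (1 / chain_const d v Fs) * det (hat_matrix d v Fs) ^ d)"

end

theory Submission
  imports Defs
begin

text \<open>Let \<open>D\<close> be the determinantal sum of a general configuration \<open>v\<close>, and apply differential
  operators of degree \<open>d\<close> to it. Since \<open>(\<Sum>\<^sub>F a\<^sub>F x\<^sub>F)\<^sup>d\<close> has the constants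
  \<open>d! \<Prod>\<^sub>F a\<^sub>F\<^bsup>m\<^sub>F\<^esup>\<close> as its derivatives, a monomial \<open>m\<close> acts on \<open>D\<close> as the sum of
  \<open>\<Prod>\<^sub>F a\<^sub>F\<^bsup>m\<^sub>F - 1\<^esup>\<close> over the maximal chains that contain its support. Hence incomparable products
  act as 0 and maximal chains as 1. A linear form that comes from a coordinate of \<open>v\<close> acts as 0, because
  \<open>(a\<^sub>F)\<^sub>F\<close> spans the kernel of the matrix with columns \<open>v\<^sub>F\<close>. By genericity these special forms
  restrict to all linear functions on a cone that is not maximal, so they can be used to trade squares
  in a monomial for larger support; this reduces the vanishing of arbitrary linear forms to the
  balancing condition at cones of codimension one. The same trade, together with the connectedness of
  the Bergman fan in codimension one, shows that the top degree of the Chow ring is spanned by any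
  maximal chain. So \<open>D\<close> itself supplies the degree map, and it is the mixed volume because a
  polynomial is determined by its derivatives.\<close>

section \<open>Polynomials\<close>

text \<open>The degree map and the mixed volume are given by definite descriptions, so their
  existence and uniqueness have to be established along with the formula; in particular the degree
  \<open>d\<close> part of the Chow ring must be shown to be one-dimensional. That one chain spans
  it would still allow it to be zero; the functional given by \<open>D\<close>, which is 1 on that
  chain, excludes this. The obstacle is one of dimension: the vectors supply a space of linear forms
  of dimension at most \<open>d - 1\<close>, while the ideal contains a form for every
  \<open>c\<close> with sum zero. This is just enough, because a flag that is not maximal has at
  most \<open>d - 1\<close> members, and a single coefficient \<open>a_F \<noteq> 0\<close> makes
  the vectors of the other \<open>d - 1\<close> flats of a maximal flag a basis. On a full maximal
  flag the values of a special form satisfy exactly the relation with coefficients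
  \<open>a_F\<close>. The constant \<open>d! a_1 ... a_d\<close> is the value on the power
  \<open>(a_1 x_1 + ... + a_d x_d)^d\<close> of the operator given by the product of all
  \<open>d\<close> variables.\<close>

abbreviation lookup where "lookup \<equiv> Poly_Mapping.lookup"
abbreviation keys where "keys \<equiv> Poly_Mapping.keys"
abbreviation single where "single \<equiv> Poly_Mapping.single"

definition mdeg :: "('x \<Rightarrow>\<^sub>0 nat) \<Rightarrow> nat" where
  "mdeg m = (\<Sum>x\<in>keys m. lookup m x)"

text \<open>The value of the differential operator with exponent \<open>m\<close> on the monomial
  with exponent \<open>m\<close>. Coefficients weighted by it turn differentiation into a mere shift
  of exponents.\<close>

definition mfact :: "('x \<Rightarrow>\<^sub>0 nat) \<Rightarrow> real" where
  "mfact m = (\<Prod>x\<in>keys m. fact (lookup m x))"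

lemma mdeg_superset: "finite K \<Longrightarrow> keys m \<subseteq> K \<Longrightarrow> mdeg m = (\<Sum>x\<in>K. lookup m x)"
  unfolding mdeg_def by (rule sum.mono_neutral_left) (auto simp: in_keys_iff)

lemma mfact_superset: "finite K \<Longrightarrow> keys m \<subseteq> K \<Longrightarrow> mfact m = (\<Prod>x\<in>K. fact (lookup m x))"
  unfolding mfact_def by (rule prod.mono_neutral_left) (auto simp: in_keys_iff)

lemma keys_add_nat: "keys (m + k) = keys m \<union> keys (k :: 'x \<Rightarrow>\<^sub>0 nat)"
  by (auto simp: in_keys_iff lookup_add)

lemma mdeg_eq_0_iff [simp]: "mdeg m = 0 \<longleftrightarrow> m = 0"
  by (auto simp: mdeg_def in_keys_iff intro!: poly_mapping_eqI)

lemma mdeg_single [simp]: "mdeg (single x k) = k"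
  by (cases "k = 0") (auto simp: mdeg_def)

lemma mdeg_add [simp]: "mdeg (m + k) = mdeg m + mdeg k"
proof -
  let ?K = "keys m \<union> keys k"
  have "mdeg (m + k) = (\<Sum>x\<in>?K. lookup m x + lookup k x)"
    by (subst mdeg_superset[of ?K]) (auto simp: keys_add_nat lookup_add)
  also have "\<dots> = mdeg m + mdeg k"
    by (simp add: sum.distrib mdeg_superset[of ?K m] mdeg_superset[of ?K k])
  finally show ?thesis .
qed

lemma mfact_nonzero [simp]: "mfact m \<noteq> 0"
  by (simp add: mfact_def)

lemma mfact_add_single: "mfact (m + single x 1) = (real (lookup m x) + 1) * mfact m"
proof -
  let ?K = "insert x (keys m)"
  have "mfact (m + single x 1) = (\<Prod>y\<in>?K. fact (lookup (m + single x 1) y))"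
    by (rule mfact_superset) (auto simp: keys_add_nat)
  also have "\<dots> = fact (lookup m x + 1) * (\<Prod>y\<in>?K - {x}. fact (lookup m y))"
    by (subst prod.remove[of _ x]) (auto simp: lookup_add lookup_single when_def intro!: prod.cong split: if_splits)
  also have "\<dots> = (real (lookup m x) + 1) * (\<Prod>y\<in>?K. fact (lookup m y))"
    by (subst (2) prod.remove[of _ x]) (auto simp: algebra_simps)
  also have "(\<Prod>y\<in>?K. fact (lookup m y)) = mfact m"
    by (rule mfact_superset[symmetric]) auto
  finally show ?thesis .
qed

lemma homogeneous_iff: "homogeneous k p \<longleftrightarrow> (\<forall>m\<in>keys p. mdeg m = k)"
  by (simp add: homogeneous_def mdeg_def)

lemma homogeneous_lookup: "homogeneous k p \<Longrightarrow> mdeg m \<noteq> k \<Longrightarrow> lookup p m = 0"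
  by (auto simp: homogeneous_iff in_keys_iff)

lemma homogeneousI: "(\<And>m. lookup p m \<noteq> 0 \<Longrightarrow> mdeg m = k) \<Longrightarrow> homogeneous k p"
  by (auto simp: homogeneous_iff in_keys_iff)

lemma homogeneous_single [simp]: "mdeg m = k \<Longrightarrow> homogeneous k (single m c)"
  by (intro homogeneousI) (auto simp: lookup_single when_def split: if_splits)

lemma homogeneous_0 [simp]: "homogeneous k 0"
  by (simp add: homogeneous_iff)

lemma homogeneous_add: "homogeneous k p \<Longrightarrow> homogeneous k q \<Longrightarrow> homogeneous k (p + q)"
  using keys_add[of p q] by (auto simp: homogeneous_iff)

lemma homogeneous_diff: "homogeneous k p \<Longrightarrow> homogeneous k q \<Longrightarrow> homogeneous k (p - q)"
  using keys_add[of p "- q"] by (auto simp: homogeneous_iff in_keys_iff lookup_minus lookup_add)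

lemma homogeneous_sum:
  "(\<And>i. i \<in> A \<Longrightarrow> homogeneous k (f i)) \<Longrightarrow> homogeneous k (sum f A)"
  by (induction A rule: infinite_finite_induct) (auto intro: homogeneous_add)

lemma homogeneous_mult:
  assumes "homogeneous k p" "homogeneous l q"
  shows "homogeneous (k + l) (p * q)"
  unfolding homogeneous_iff
proof
  fix m assume "m \<in> keys (p * q)"
  then obtain a b where "a \<in> keys p" "b \<in> keys q" "m = a + b"
    using keys_mult[of p q] by blast
  then show "mdeg m = k + l" using assms by (simp add: homogeneous_iff)
qed

lemma homogeneous_power: "homogeneous k p \<Longrightarrow> homogeneous (n * k) (p ^ n)"
  by (induction n) (auto simp: homogeneous_mult simp flip: single_one)

lemma homogeneous_PConst: "homogeneous 0 (PConst c)"
  by (simp add: PConst_def)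

lemma homogeneous_PVar: "homogeneous 1 (PVar x)"
  by (simp add: PVar_def)

lemma homogeneous_scale: "homogeneous k p \<Longrightarrow> homogeneous k (PConst r * p)"
  using homogeneous_mult[OF homogeneous_PConst] by fastforce

lemma polys_in_iff: "p \<in> polys_in V \<longleftrightarrow> (\<forall>m. lookup p m \<noteq> 0 \<longrightarrow> keys m \<subseteq> V)"
  by (auto simp: polys_in_def in_keys_iff)

lemma polys_in_0 [simp]: "0 \<in> polys_in V"
  by (simp add: polys_in_def)

lemma polys_in_1 [simp]: "1 \<in> polys_in V"
  by (auto simp: polys_in_iff lookup_one when_def split: if_splits)

lemma polys_in_single [simp]: "keys m \<subseteq> V \<Longrightarrow> single m c \<in> polys_in V"
  by (auto simp: polys_in_iff lookup_single when_def split: if_splits)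

lemma polys_in_PConst [simp]: "PConst c \<in> polys_in V"
  by (simp add: PConst_def)

lemma polys_in_PVar [simp]: "x \<in> V \<Longrightarrow> PVar x \<in> polys_in V"
  by (simp add: PVar_def)

lemma polys_in_add [simp]: "p \<in> polys_in V \<Longrightarrow> q \<in> polys_in V \<Longrightarrow> p + q \<in> polys_in V"
  using keys_add[of p q] by (auto simp: polys_in_def)

lemma polys_in_uminus [simp]: "p \<in> polys_in V \<Longrightarrow> - p \<in> polys_in V"
  by (simp add: polys_in_iff)

lemma polys_in_diff [simp]: "p \<in> polys_in V \<Longrightarrow> q \<in> polys_in V \<Longrightarrow> p - q \<in> polys_in V"
  using polys_in_add[of p V "- q"] by simp

lemma polys_in_mult [simp]: "p \<in> polys_in V \<Longrightarrow> q \<in> polys_in V \<Longrightarrow> p * q \<in> polys_in V"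
  unfolding polys_in_def
proof (clarsimp, goal_cases)
  case (1 m x)
  then obtain a b where "a \<in> keys p" "b \<in> keys q" "m = a + b"
    using keys_mult[of p q] by blast
  then show ?case using 1 by (auto simp: keys_add_nat)
qed

lemma polys_in_sum [simp]: "(\<And>i. i \<in> A \<Longrightarrow> f i \<in> polys_in V) \<Longrightarrow> sum f A \<in> polys_in V"
  by (induction A rule: infinite_finite_induct) auto

lemma polys_in_power [simp]: "p \<in> polys_in V \<Longrightarrow> p ^ n \<in> polys_in V"
  by (induction n) auto

lemma cring_poly_ring: "cring (poly_ring V)"
proof (rule cringI)
  show "abelian_group (poly_ring V)"
  proof (rule abelian_groupI)
    fix x assume "x \<in> carrier (poly_ring V)"
    then show "\<exists>y\<in>carrier (poly_ring V). y \<oplus>\<^bsub>poly_ring V\<^esub> x = \<zero>\<^bsub>poly_ring V\<^esub>"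
      by (intro bexI[of _ "- x"]) (auto simp: poly_ring_def)
  qed (auto simp: poly_ring_def add.assoc add.commute)
  show "Group.comm_monoid (poly_ring V)"
    by (rule comm_monoidI) (auto simp: poly_ring_def mult.assoc mult.commute)
qed (auto simp: poly_ring_def distrib_right)

lemma PConst_0 [simp]: "PConst 0 = 0"
  and PConst_1 [simp]: "PConst 1 = 1"
  by (auto simp: PConst_def)

lemma PConst_add: "PConst (a + b) = PConst a + PConst b"
  by (simp add: PConst_def single_add)

lemma PConst_mult: "PConst (a * b) = PConst a * PConst b"
  by (simp add: PConst_def mult_single)

lemma PConst_inject: "PConst a = PConst b \<longleftrightarrow> a = b"
  unfolding PConst_def by (metis lookup_single_eq)

lemma single_sum: "single k (sum f A) = (\<Sum>i\<in>A. single k (f i))"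
  by (induction A rule: infinite_finite_induct) (auto simp: single_add)

lemma PConst_hom: "comm_ring_hom PConst"
  by unfold_locales (auto simp: PConst_add PConst_mult)

lemma PConst_single: "PConst a * single m b = single m (a * b)"
  by (simp add: PConst_def mult_single)

lemma lookup_PConst_times: "lookup (PConst a * p) m = a * lookup p m"
  by (simp add: PConst_def flip: mult_map_scale_conv_mult)
     (simp add: Poly_Mapping.map.rep_eq when_def)

lemma poly_eq_sum_singles:
  assumes "finite K" "keys p \<subseteq> K"
  shows "p = (\<Sum>m\<in>K. single m (lookup p m))"
proof (rule poly_mapping_eqI)
  fix k
  show "lookup p k = lookup (\<Sum>m\<in>K. single m (lookup p m)) k"
    using assms by (auto simp: lookup_sum lookup_single when_def if_distrib in_keys_iff sum.delta)
qed

lemma lookup_PVar_times: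
  "lookup (PVar x * p) m = (if x \<in> keys m then lookup p (m - single x 1) else 0)"
proof -
  have *: "single x 1 + k = m \<longleftrightarrow> x \<in> keys m \<and> k = m - single x (1::nat)" for k
  proof
    assume "single x 1 + k = m"
    then show "x \<in> keys m \<and> k = m - single x 1"
      by (auto simp: keys_add_nat)
  next
    assume "x \<in> keys m \<and> k = m - single x 1"
    then show "single x 1 + k = m"
      by (intro poly_mapping_eqI) (auto simp: lookup_add lookup_minus lookup_single in_keys_iff when_def)
  qed
  have "PVar x * p = (\<Sum>k\<in>keys p. single (single x 1 + k) (lookup p k))"
    by (subst poly_eq_sum_singles[of "keys p" p]) (auto simp: sum_distrib_left PVar_def mult_single)
  then have "lookup (PVar x * p) m = (\<Sum>k\<in>keys p. lookup p k when single x 1 + k = m)"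
    by (simp add: lookup_sum lookup_single)
  also have "\<dots> = (\<Sum>k\<in>keys p. if k = m - single x 1 then (if x \<in> keys m then lookup p k else 0) else 0)"
    by (rule sum.cong) (auto simp: * when_def simp del: One_nat_def)
  also have "\<dots> = (if x \<in> keys m then lookup p (m - single x 1) else 0)"
    by (auto simp: sum.delta in_keys_iff)
  finally show ?thesis .
qed

section \<open>Squarefree monomials and powers of linear forms\<close>

definition sqfree :: "'x set \<Rightarrow> 'x \<Rightarrow>\<^sub>0 nat" where
  "sqfree S = (\<Sum>x\<in>S. single x 1)"

lemma lookup_sqfree: "finite S \<Longrightarrow> lookup (sqfree S) x = (if x \<in> S then 1 else 0)"
  by (auto simp: sqfree_def lookup_sum lookup_single when_def)

lemma keys_sqfree [simp]: "finite S \<Longrightarrow> keys (sqfree S) = S"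
  by (auto simp: in_keys_iff lookup_sqfree split: if_splits)

lemma mdeg_sqfree [simp]: "finite S \<Longrightarrow> mdeg (sqfree S) = card S"
  by (simp add: mdeg_def lookup_sqfree)

lemma sqfree_insert: "finite S \<Longrightarrow> x \<notin> S \<Longrightarrow> sqfree (insert x S) = sqfree S + single x 1"
  by (simp add: sqfree_def add.commute)

lemma prod_list_PVar: "distinct xs \<Longrightarrow> prod_list (map PVar xs) = single (sqfree (set xs)) 1"
proof (induction xs)
  case (Cons x xs)
  then show ?case
    by (simp add: sqfree_insert PVar_def mult_single add.commute)
qed (simp add: sqfree_def)

lemma squarefree_eq_sqfree:
  assumes "\<And>x. lookup m x \<le> 1"
  shows "m = sqfree (keys m)"
proof (rule poly_mapping_eqI)
  fix x
  show "lookup m x = lookup (sqfree (keys m)) x"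
    using assms[of x] by (auto simp: lookup_sqfree in_keys_iff)
qed

lemma card_keys_le_mdeg: "card (keys m) \<le> mdeg m"
  unfolding mdeg_def card_eq_sum by (rule sum_mono) (auto simp: in_keys_iff Suc_le_eq)

lemma squarefree_if_card_eq:
  assumes "card (keys m) = mdeg m"
  shows "m = sqfree (keys m)"
proof (rule squarefree_eq_sqfree)
  fix x
  have "(\<Sum>x\<in>keys m. 1) = (\<Sum>x\<in>keys m. lookup m x)"
    using assms by (simp add: mdeg_def)
  then have "1 = lookup m x" if "x \<in> keys m"
    by (rule sum_mono_inv) (use that in \<open>auto simp: in_keys_iff Suc_le_eq\<close>)
  then show "lookup m x \<le> 1" by (cases "x \<in> keys m") (auto simp: in_keys_iff)
qed

text \<open>The condition \<open>x \<in> keys m'\<close> records that the square of \<open>x\<close>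
  divides \<open>m\<close>. One factor \<open>x\<close> can then be exchanged for a new variable
  without losing \<open>x\<close> from the support, which therefore grows.\<close>

lemma squarefree_or_square:
  assumes "card (keys m) < mdeg m"
  obtains x m' where "x \<in> keys m'" "m = m' + single x 1"
proof -
  obtain x where x: "2 \<le> lookup m x"
  proof (rule ccontr)
    assume "\<not> thesis"
    have "\<And>x. lookup m x \<le> 1"
    proof (rule ccontr)
      fix x assume "\<not> lookup m x \<le> 1"
      then have "2 \<le> lookup m x" by simp
      with that \<open>\<not> thesis\<close> show False by blast
    qed
    then have "m = sqfree (keys m)" by (rule squarefree_eq_sqfree)
    then have "mdeg m = mdeg (sqfree (keys m))" by simp
    also have "\<dots> = card (keys m)" by simp
    finally have "mdeg m = card (keys m)" .
    with assms show False by simp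
  qed
  show thesis
  proof (rule that)
    show "x \<in> keys (m - single x 1)" using x by (simp add: in_keys_iff lookup_minus)
    show "m = m - single x 1 + single x 1"
      using x by (intro poly_mapping_eqI) (auto simp: lookup_minus lookup_add lookup_single when_def)
  qed
qed

text \<open>The multinomial theorem with its denominators cleared by \<open>mfact\<close>. In this
  form it can be proved by splitting off one linear factor, without multinomial
  coefficients.\<close>

lemma lookup_linear_power:
  fixes a :: "'x \<Rightarrow> real"
  assumes "finite S" "mdeg m = k"
  shows "mfact m * lookup ((\<Sum>x\<in>S. PConst (a x) * PVar x) ^ k) m =
    (if keys m \<subseteq> S then fact k * (\<Prod>x\<in>S. a x ^ lookup m x) else 0)"
  using assms(2)
proof (induction k arbitrary: m)
  case 0
  then show ?case by (simp add: mfact_def)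
next
  case (Suc k)
  let ?L = "\<Sum>x\<in>S. PConst (a x) * PVar x"
  have m: "m = (m - single x 1) + single x 1" if "x \<in> keys m" for x
    using that by (intro poly_mapping_eqI) (auto simp: lookup_minus lookup_add lookup_single when_def in_keys_iff)
  have deg: "mdeg (m - single x 1) = k" if "x \<in> keys m" for x
  proof -
    have "mdeg m = mdeg (m - single x 1) + 1"
      by (subst m[OF that]) (simp only: mdeg_add mdeg_single)
    then show ?thesis using Suc.prems by simp
  qed
  have keys_sub: "keys (m - single x 1) \<subseteq> S \<longleftrightarrow> keys m \<subseteq> S" if "x \<in> keys m" "x \<in> S" for x
    by (subst (2) m[OF that(1)], subst keys_add_nat) (use that in auto)
  have "mfact m * lookup (?L ^ Suc k) m =
      (\<Sum>x\<in>S. if x \<in> keys m then a x * (mfact m * lookup (?L ^ k) (m - single x 1)) else 0)"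
    unfolding power_Suc sum_distrib_right lookup_sum sum_distrib_left
    by (intro sum.cong) (auto simp: mult.assoc lookup_PConst_times lookup_PVar_times)
  also have "\<dots> = (\<Sum>x\<in>S. if keys m \<subseteq> S
      then real (lookup m x) * (fact k * (\<Prod>y\<in>S. a y ^ lookup m y)) else 0)"
  proof (rule sum.cong[OF refl])
    fix x assume x: "x \<in> S"
    show "(if x \<in> keys m then a x * (mfact m * lookup (?L ^ k) (m - single x 1)) else 0) =
      (if keys m \<subseteq> S then real (lookup m x) * (fact k * (\<Prod>y\<in>S. a y ^ lookup m y)) else 0)"
    proof (cases "x \<in> keys m")
      case True
      have mf: "mfact m = real (lookup m x) * mfact (m - single x 1)"
        by (subst m[OF True], subst mfact_add_single)
          (use True in \<open>simp add: lookup_minus in_keys_iff of_nat_diff Suc_le_eq\<close>)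
      have "(\<Prod>y\<in>S. a y ^ lookup m y) = a x * (\<Prod>y\<in>S. a y ^ lookup (m - single x 1) y)"
        unfolding prod.remove[OF assms(1) x]
        using True by (cases "lookup m x")
          (auto simp: lookup_minus lookup_single when_def in_keys_iff intro!: prod.cong)
      then show ?thesis
        using True Suc.IH[OF deg[OF True]] keys_sub[OF True x] unfolding mf
        by (simp add: mult.assoc mult.left_commute)
    qed (auto simp: in_keys_iff)
  qed
  also have "\<dots> = (if keys m \<subseteq> S then real (\<Sum>x\<in>S. lookup m x) * (fact k * (\<Prod>y\<in>S. a y ^ lookup m y)) else 0)"
    by (simp add: sum_distrib_right)
  \<comment> \<open>The exponents of \<open>m\<close> add up to \<open>Suc k\<close>, which is the
    factor missing from the factorial.\<close>
  also have "\<dots> = (if keys m \<subseteq> S then fact (Suc k) * (\<Prod>y\<in>S. a y ^ lookup m y) else 0)"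
    using Suc.prems by (auto simp: mdeg_superset[OF assms(1)] algebra_simps simp del: of_nat_sum)
  finally show ?case .
qed

section \<open>Differential operators in terms of coefficients\<close>

lemma lookup_partial_diff:
  "lookup (partial_diff x p) k = (real (lookup k x) + 1) * lookup p (k + single x 1)"
proof -
  have eq: "m = k + single x 1" if "m - single x 1 = k" "lookup m x \<noteq> 0" for m
    using that by (intro poly_mapping_eqI) (auto simp: lookup_add lookup_minus lookup_single when_def)
  have "lookup (partial_diff x p) k =
      (\<Sum>m\<in>keys p. real (lookup m x) * lookup p m when m - single x 1 = k)"
    by (simp add: partial_diff_def lookup_sum lookup_single)
  also have "\<dots> = (\<Sum>m\<in>keys p. if m = k + single x 1 then (real (lookup k x) + 1) * lookup p m else 0)"
    by (rule sum.cong)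
      (use eq in \<open>auto simp: when_def lookup_add lookup_minus lookup_single simp del: One_nat_def\<close>)
  also have "\<dots> = (real (lookup k x) + 1) * lookup p (k + single x 1)"
    by (auto simp: sum.delta in_keys_iff)
  finally show ?thesis .
qed

text \<open>Each derivative produces the factor by which \<open>mfact\<close> grows when the
  exponent is raised by one, so for weighted coefficients only the shift of the exponent
  remains.\<close>

lemma lookup_partial_diff_power:
  "mfact k * lookup ((partial_diff x ^^ j) p) k = mfact (k + single x j) * lookup p (k + single x j)"
proof (induction j arbitrary: k)
  case (Suc j)
  have "mfact k * lookup ((partial_diff x ^^ Suc j) p) k =
      mfact (k + single x 1) * lookup ((partial_diff x ^^ j) p) (k + single x 1)"
    by (simp add: lookup_partial_diff mfact_add_single[simplified])
  also have "\<dots> = mfact (k + single x 1 + single x j) * lookup p (k + single x 1 + single x j)"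
    by (rule Suc.IH)
  also have "k + single x 1 + single x j = k + single x (Suc j)"
    by (simp add: add.assoc flip: single_add)
  finally show ?case .
qed simp

text \<open>The shifts for different variables commute because exponents add, so the fold does not
  depend on the order, and the shifts over the support of \<open>m\<close> add up to
  \<open>m\<close>.\<close>

lemma lookup_monom_diff:
  "mfact k * lookup (monom_diff m p) k = mfact (k + m) * lookup p (k + m)"
proof -
  define f where "f = (\<lambda>x (q::'a rpoly). (partial_diff x ^^ lookup m x) q)"
  interpret comp_fun_commute f
  proof
    fix y x
    show "f y \<circ> f x = f x \<circ> f y"
    proof (rule ext, rule poly_mapping_eqI)
      fix q k
      have "mfact k * lookup (f y (f x q)) k = mfact k * lookup (f x (f y q)) k"
        unfolding f_def lookup_partial_diff_power by (simp add: ac_simps)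
      then show "lookup ((f y \<circ> f x) q) k = lookup ((f x \<circ> f y) q) k" by simp
    qed
  qed
  have "mfact k * lookup (Finite_Set.fold f p S) k =
    mfact (k + (\<Sum>x\<in>S. single x (lookup m x))) * lookup p (k + (\<Sum>x\<in>S. single x (lookup m x)))"
    if "finite S" for S k
    using that
  proof (induction S arbitrary: k)
    case (insert x S)
    have "Finite_Set.fold f p (insert x S) = f x (Finite_Set.fold f p S)"
      using insert.hyps by simp
    then have "mfact k * lookup (Finite_Set.fold f p (insert x S)) k =
        mfact (k + single x (lookup m x)) * lookup (Finite_Set.fold f p S) (k + single x (lookup m x))"
      using lookup_partial_diff_power[of k "lookup m x" x "Finite_Set.fold f p S"]
      by (simp add: f_def)
    then show ?case using insert by (simp add: add.assoc)
  qed simp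
  from this[of "keys m" k] show ?thesis
    unfolding monom_diff_def f_def by (simp flip: poly_eq_sum_singles)
qed

lemma monom_diff_homogeneous:
  assumes "homogeneous d p" "mdeg m = d"
  shows "monom_diff m p = PConst (mfact m * lookup p m)"
proof (rule poly_mapping_eqI)
  fix k
  show "lookup (monom_diff m p) k = lookup (PConst (mfact m * lookup p m)) k"
  proof (cases "k = 0")
    case True
    then show ?thesis
      using lookup_monom_diff[of 0 m p] by (simp add: PConst_def mfact_def[of 0])
  next
    case False
    then have "lookup p (k + m) = 0"
      using assms by (intro homogeneous_lookup[OF assms(1)]) auto
    then show ?thesis
      using lookup_monom_diff[of k m p] False by (simp add: PConst_def lookup_single)
  qed
qed

section \<open>Linear functionals given by their values on monomials\<close>

definition linear_ext :: "(('x \<Rightarrow>\<^sub>0 nat) \<Rightarrow> real) \<Rightarrow> 'x rpoly \<Rightarrow> real" where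
  "linear_ext h p = (\<Sum>m\<in>keys p. lookup p m * h m)"

lemma linear_ext_superset:
  "finite K \<Longrightarrow> keys p \<subseteq> K \<Longrightarrow> linear_ext h p = (\<Sum>m\<in>K. lookup p m * h m)"
  unfolding linear_ext_def by (rule sum.mono_neutral_left) (auto simp: in_keys_iff)

lemma linear_ext_0 [simp]: "linear_ext h 0 = 0"
  by (simp add: linear_ext_def)

lemma linear_ext_single [simp]: "linear_ext h (single m c) = c * h m"
  by (subst linear_ext_superset[of "{m}"]) auto

lemma linear_ext_add: "linear_ext h (p + q) = linear_ext h p + linear_ext h q"
proof -
  let ?K = "keys p \<union> keys q"
  have "keys (p + q) \<subseteq> ?K" by (rule keys_add)
  then show ?thesis
    by (simp add: linear_ext_superset[of ?K] lookup_add algebra_simps sum.distrib)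
qed

lemma linear_ext_uminus: "linear_ext h (- p) = - linear_ext h p"
  by (simp add: linear_ext_def sum_negf)

lemma linear_ext_diff: "linear_ext h (p - q) = linear_ext h p - linear_ext h q"
  using linear_ext_add[of h p "- q"] by (simp add: linear_ext_uminus)

lemma linear_ext_sum: "linear_ext h (sum f A) = (\<Sum>i\<in>A. linear_ext h (f i))"
  by (induction A rule: infinite_finite_induct) (auto simp: linear_ext_add)

lemma linear_ext_PConst_times: "linear_ext h (PConst c * p) = c * linear_ext h p"
proof -
  have "keys (PConst c * p) \<subseteq> keys p"
    by (auto simp: in_keys_iff lookup_PConst_times)
  then show ?thesis
    by (simp add: linear_ext_superset[of "keys p"] lookup_PConst_times sum_distrib_left mult.assoc)
qed

text \<open>Reduces the vanishing of a functional on all multiples of \<open>q\<close> to its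
  vanishing on monomial multiples.\<close>

lemma linear_ext_times:
  "linear_ext h (p * q) = (\<Sum>m\<in>keys p. lookup p m * linear_ext h (single m 1 * q))"
proof -
  have "p * q = (\<Sum>m\<in>keys p. PConst (lookup p m) * (single m 1 * q))"
    by (subst poly_eq_sum_singles[of "keys p" p])
      (simp_all add: sum_distrib_right PConst_single flip: mult.assoc)
  then show ?thesis by (simp add: linear_ext_sum linear_ext_PConst_times)
qed

lemma apply_diff_homogeneous:
  assumes "homogeneous d p" "homogeneous d f"
  shows "apply_diff f p = PConst (linear_ext (\<lambda>m. mfact m * lookup p m) f)"
proof -
  interpret comm_ring_hom PConst by (rule PConst_hom)
  have "apply_diff f p = (\<Sum>m\<in>keys f. PConst (lookup f m * (mfact m * lookup p m)))"
    unfolding apply_diff_def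
    by (rule sum.cong)
      (use assms in \<open>auto simp: homogeneous_iff[of d f] monom_diff_homogeneous PConst_mult\<close>)
  then show ?thesis by (simp add: linear_ext_def hom_sum)
qed

lemma homogeneous_eqI:
  assumes "homogeneous d p" "homogeneous d q"
    and "\<And>m. mdeg m = d \<Longrightarrow> lookup p m = lookup q m"
  shows "p = q"
proof (rule poly_mapping_eqI)
  fix m
  show "lookup p m = lookup q m"
    using assms by (cases "mdeg m = d") (auto simp: homogeneous_lookup)
qed

section \<open>Flats and chains of flats\<close>

context matroid
begin

abbreviation rk where "rk \<equiv> rank_of indep"
abbreviation cl where "cl \<equiv> matroid_closure E indep"

lemma finite_indep_subsets: "finite {X. X \<subseteq> A \<and> indep X}"
  by (rule finite_subset[of _ "Pow E"]) (use indep_subset_ground finite_ground in auto)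

lemma finite_indep: "indep X \<Longrightarrow> finite X"
  using indep_subset_ground finite_ground finite_subset by blast

lemma rk_ge: "X \<subseteq> A \<Longrightarrow> indep X \<Longrightarrow> card X \<le> rk A"
  unfolding rank_of_def using finite_indep_subsets[of A] by (intro Max_ge) auto

lemma rk_basis: obtains X where "X \<subseteq> A" "indep X" "card X = rk A"
proof -
  have "rk A \<in> card ` {X. X \<subseteq> A \<and> indep X}"
    unfolding rank_of_def using finite_indep_subsets[of A] indep_empty by (intro Max_in) auto
  then show thesis using that by auto
qed

lemma rk_mono:
  assumes "A \<subseteq> B"
  shows "rk A \<le> rk B"
proof -
  obtain X where X: "X \<subseteq> A" "indep X" "card X = rk A" by (rule rk_basis)
  have "X \<subseteq> B" using X(1) assms by (rule order_trans)
  then show ?thesis using rk_ge[OF _ X(2)] X(3) by simp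
qed

lemma rk_empty [simp]: "rk {} = 0"
  by (rule rk_basis[of "{}"]) auto

lemma extend_to_basis:
  assumes "indep X" "X \<subseteq> A"
  obtains B where "X \<subseteq> B" "B \<subseteq> A" "indep B" "card B = rk A"
proof -
  have "\<exists>B. X \<subseteq> B \<and> B \<subseteq> A \<and> indep B \<and> card B = rk A"
    using assms
  proof (induction "rk A - card X" arbitrary: X)
    case 0
    then show ?case using rk_ge[of X A] by (intro exI[of _ X]) auto
  next
    case (Suc k)
    obtain Y where Y: "Y \<subseteq> A" "indep Y" "card Y = rk A" by (rule rk_basis)
    then have "card X < card Y" using Suc.hyps(2) by simp
    then obtain y where y: "y \<in> Y - X" "indep (insert y X)"
      using augment[OF Suc.prems(1) Y(2)] by blast
    have "card (insert y X) = Suc (card X)"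
      using y finite_indep[OF Suc.prems(1)] by auto
    then have "k = rk A - card (insert y X)" using Suc.hyps(2) by simp
    moreover have "insert y X \<subseteq> A" using y Y Suc.prems by blast
    ultimately obtain B where "insert y X \<subseteq> B" "B \<subseteq> A" "indep B" "card B = rk A"
      using Suc.hyps(1) y(2) by blast
    then show ?case by blast
  qed
  then show thesis using that by blast
qed

lemma rk_insert_le: "rk (insert x A) \<le> Suc (rk A)"
proof -
  obtain X where X: "X \<subseteq> insert x A" "indep X" "card X = rk (insert x A)" by (rule rk_basis)
  have "card (X - {x}) \<le> rk A"
    by (rule rk_ge) (use X indep_subset in auto)
  moreover have "card X \<le> Suc (card (X - {x}))"
    using finite_indep[OF X(2)] by (cases "x \<in> X") (auto simp: card_Diff_singleton)
  ultimately show ?thesis using X(3) by simp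
qed

text \<open>The part of submodularity of the rank that closure operators rest on. If
  \<open>x\<close> raised the rank of \<open>B\<close>, then a basis of \<open>A\<close>, extended
  to a basis of \<open>B\<close> and further to one of \<open>insert x B\<close>, would have to pick
  up \<open>x\<close>; the basis of \<open>A\<close> together with \<open>x\<close> would then be
  independent.\<close>

lemma rk_insert_eq_mono:
  assumes "A \<subseteq> B" "rk (insert x A) = rk A"
  shows "rk (insert x B) = rk B"
proof (rule ccontr)
  assume neq: "rk (insert x B) \<noteq> rk B"
  then have less: "rk B < rk (insert x B)"
    using rk_mono[OF subset_insertI, of B x] by linarith
  obtain X where X: "X \<subseteq> A" "indep X" "card X = rk A" by (rule rk_basis)
  obtain Y where Y: "X \<subseteq> Y" "Y \<subseteq> B" "indep Y" "card Y = rk B"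
    using extend_to_basis[OF X(2), of B] X(1) assms(1) by blast
  obtain Z where Z: "Y \<subseteq> Z" "Z \<subseteq> insert x B" "indep Z" "card Z = rk (insert x B)"
    using extend_to_basis[OF Y(3), of "insert x B"] Y(2) by blast
  have "\<not> Z \<subseteq> B" using rk_ge[of Z B] Z less by auto
  then have x: "x \<in> Z" "x \<notin> B" using Z by auto
  have "indep (insert x X)" by (rule indep_subset[OF Z(3)]) (use x Y Z in auto)
  then have "card (insert x X) \<le> rk (insert x A)"
    by (intro rk_ge) (use X in auto)
  moreover have "x \<notin> X" using x X assms by auto
  ultimately show False
    using assms(2) X finite_indep[OF X(2)] by simp
qed

section \<open>Closures and the lattice of flats\<close>

lemma mem_closure_iff: "x \<in> cl A \<longleftrightarrow> x \<in> E \<and> rk (insert x A) = rk A"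
  unfolding matroid_closure_def by blast

lemma closure_subset_ground: "cl A \<subseteq> E"
  using mem_closure_iff by blast

lemma subset_closure: "A \<subseteq> E \<Longrightarrow> A \<subseteq> cl A"
  by (auto simp: mem_closure_iff insert_absorb)

lemma rk_closure [simp]:
  assumes "A \<subseteq> E"
  shows "rk (cl A) = rk A"
proof -
  have "rk (A \<union> S) = rk A" if "finite S" "S \<subseteq> cl A" for S
    using that
  proof (induction S)
    case (insert x S)
    have "rk (insert x A) = rk A" using insert.prems by (simp add: mem_closure_iff)
    then have "rk (insert x (A \<union> S)) = rk (A \<union> S)" by (rule rk_insert_eq_mono[OF Un_upper1])
    also have "\<dots> = rk A" using insert.IH insert.prems by blast
    finally show ?case by simp
  qed simp
  moreover have "finite (cl A)" by (rule finite_subset[OF closure_subset_ground finite_ground])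
  ultimately have "rk (A \<union> cl A) = rk A" by blast
  then show ?thesis unfolding Un_absorb1[OF subset_closure[OF assms]] .
qed

lemma closure_flat:
  assumes "A \<subseteq> E"
  shows "cl A \<in> flats E indep"
proof -
  have "cl (cl A) \<subseteq> cl A"
  proof
    fix x assume "x \<in> cl (cl A)"
    then have x: "x \<in> E" "rk (insert x (cl A)) = rk (cl A)"
      by (auto simp only: mem_closure_iff[of x "cl A"])
    have "rk (insert x A) \<le> rk (insert x (cl A))"
      by (intro rk_mono insert_mono subset_closure assms)
    also have "\<dots> = rk A" unfolding x(2) by (rule rk_closure[OF assms])
    finally have "rk (insert x A) = rk A"
      using rk_mono[OF subset_insertI, of A x] by (rule le_antisym)
    then show "x \<in> cl A" using x(1) by (simp add: mem_closure_iff)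
  qed
  then have "cl (cl A) = cl A"
    by (rule antisym) (rule subset_closure[OF closure_subset_ground])
  then show ?thesis unfolding flats_def using closure_subset_ground[of A] by blast
qed

lemma closure_least:
  assumes "A \<subseteq> F" "F \<in> flats E indep"
  shows "cl A \<subseteq> F"
proof
  fix x assume "x \<in> cl A"
  then have x: "x \<in> E" "rk (insert x A) = rk A" by (simp_all add: mem_closure_iff)
  then have "x \<in> cl F"
    using rk_insert_eq_mono[OF assms(1) x(2)] by (simp add: mem_closure_iff)
  then show "x \<in> F" using assms(2) by (simp add: flats_def)
qed

lemma flat_subset_ground: "F \<in> flats E indep \<Longrightarrow> F \<subseteq> E"
  by (simp add: flats_def)

lemma ground_flat: "E \<in> flats E indep"
proof -
  have "cl E = E"
    by (intro equalityI closure_subset_ground subset_closure order_refl)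
  then show ?thesis by (simp add: flats_def)
qed

lemma rk_insert_flat:
  assumes "F \<in> flats E indep" "x \<in> E - F"
  shows "rk (insert x F) = Suc (rk F)"
proof -
  have "x \<notin> cl F" using assms by (simp add: flats_def)
  then have "rk (insert x F) \<noteq> rk F" using assms by (simp add: mem_closure_iff)
  then show ?thesis using rk_insert_le[of x F] rk_mono[OF subset_insertI, of F x] by linarith
qed

lemma rk_flat_strict_mono:
  assumes "F \<in> flats E indep" "F \<subset> G" "G \<subseteq> E"
  shows "rk F < rk G"
proof -
  obtain x where x: "x \<in> G - F" using assms by auto
  then have "rk (insert x F) = Suc (rk F)" using assms by (intro rk_insert_flat) auto
  moreover have "rk (insert x F) \<le> rk G" using x assms by (intro rk_mono) auto
  ultimately show ?thesis by simp
qed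

lemma flat_eqI:
  assumes "F \<in> flats E indep" "G \<in> flats E indep" "F \<subseteq> G" "rk G \<le> rk F"
  shows "F = G"
  using rk_flat_strict_mono[of F G] assms flat_subset_ground by fastforce

lemma cover_flat:
  assumes "F \<in> flats E indep" "x \<in> E - F"
  shows "cl (insert x F) \<in> flats E indep" "rk (cl (insert x F)) = Suc (rk F)"
    "insert x F \<subseteq> cl (insert x F)"
proof -
  have "insert x F \<subseteq> E" using assms flat_subset_ground by auto
  then show "cl (insert x F) \<in> flats E indep" "rk (cl (insert x F)) = Suc (rk F)"
    "insert x F \<subseteq> cl (insert x F)"
    using rk_insert_flat[OF assms] closure_flat subset_closure by (blast, simp, blast)
qed

text \<open>A cover of \<open>A\<close> is recovered from any of its elements outside
  \<open>A\<close>. So two covers that share such an element coincide: the covers partition the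
  complement of \<open>A\<close>.\<close>

lemma cover_unique:
  assumes "A \<in> flats E indep" "F \<in> flats E indep" "A \<subseteq> F" "rk F = Suc (rk A)" "x \<in> F - A"
  shows "F = cl (insert x A)"
proof -
  have x: "x \<in> E - A" using assms flat_subset_ground by auto
  have "cl (insert x A) \<subseteq> F" using assms by (intro closure_least) auto
  then have "cl (insert x A) = F"
    using cover_flat[OF assms(1) x] assms by (intro flat_eqI) auto
  then show ?thesis ..
qed

text \<open>The lattice of flats is graded: closing up with one further element of \<open>B\<close>
  raises the rank by exactly one and stays inside \<open>B\<close>.\<close>

lemma intermediate_flat:
  assumes "A \<in> flats E indep" "B \<in> flats E indep" "A \<subseteq> B" "rk A \<le> i" "i \<le> rk B"
  obtains F where "F \<in> flats E indep" "A \<subseteq> F" "F \<subseteq> B" "rk F = i"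
proof -
  have "\<exists>F. F \<in> flats E indep \<and> A \<subseteq> F \<and> F \<subseteq> B \<and> rk F = i"
    using assms(4,5)
  proof (induction i rule: dec_induct)
    case base
    then show ?case using assms by blast
  next
    case (step i)
    then obtain F where F: "F \<in> flats E indep" "A \<subseteq> F" "F \<subseteq> B" "rk F = i" by auto
    then have "\<not> B \<subseteq> F" using step.prems rk_mono[of B F] by linarith
    then obtain x where x: "x \<in> B - F" by blast
    then have "x \<in> E - F" using assms(2) flat_subset_ground by auto
    moreover have "cl (insert x F) \<subseteq> B" using x F assms(2) by (intro closure_least) auto
    ultimately show ?case using cover_flat[OF F(1)] F by blast
  qed
  then show thesis using that by blast
qed

end

section \<open>Flags of nontrivial flats\<close>

locale loopless_matroid = matroid +
  fixes d :: nat
  assumes rk_ground: "rank_of indep E = d + 1"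
    and empty_flat: "{} \<in> flats E indep"
begin

abbreviation V where "V \<equiv> nontrivial_flats E indep"
text \<open>Flags, taken as sets, are the cones of the Bergman fan; the empty flag is the zero
  cone.\<close>

abbreviation flag where "flag \<equiv> subset.chain V"
abbreviation maxflag where "maxflag \<equiv> subset.maxchain V"

lemma finite_V: "finite V"
  by (rule finite_subset[of _ "Pow E"])
    (use finite_ground in \<open>auto simp: nontrivial_flats_def flats_def\<close>)

lemma finite_V_mem: "F \<in> V \<Longrightarrow> finite F"
  using finite_ground finite_subset by (auto simp: nontrivial_flats_def flats_def)

lemma V_iff: "F \<in> V \<longleftrightarrow> F \<in> flats E indep \<and> 1 \<le> rk F \<and> rk F \<le> d"
proof
  assume F: "F \<in> V"
  then have *: "F \<in> flats E indep" "{} \<subset> F" "F \<subset> E"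
    by (auto simp: nontrivial_flats_def flats_def)
  then show "F \<in> flats E indep \<and> 1 \<le> rk F \<and> rk F \<le> d"
    using rk_flat_strict_mono[OF empty_flat *(2)] rk_flat_strict_mono[OF *(1,3)] rk_ground
    by (auto simp: flats_def)
next
  assume "F \<in> flats E indep \<and> 1 \<le> rk F \<and> rk F \<le> d"
  then show "F \<in> V"
    using rk_ground by (auto simp: nontrivial_flats_def)
qed

lemma V_flat: "F \<in> V \<Longrightarrow> F \<in> flats E indep"
  by (simp add: V_iff)

lemma flat_top_rank: "F \<in> flats E indep \<Longrightarrow> rk F = d + 1 \<Longrightarrow> F = E"
  by (rule flat_eqI) (auto simp: ground_flat rk_ground flat_subset_ground)

lemma flag_finite: "flag C \<Longrightarrow> finite C"
  using finite_V finite_subset by (auto simp: subset_chain_def)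

lemma flag_total: "flag C \<Longrightarrow> X \<in> C \<Longrightarrow> Y \<in> C \<Longrightarrow> X \<subseteq> Y \<or> Y \<subseteq> X"
  unfolding subset_chain_def by blast

lemma flag_subset: "flag C \<Longrightarrow> D \<subseteq> C \<Longrightarrow> flag D"
  unfolding subset_chain_def by blast

lemma flag_mem_V: "flag C \<Longrightarrow> F \<in> C \<Longrightarrow> F \<in> V"
  by (auto simp: subset_chain_def)

text \<open>A strict inclusion of flats increases the rank, so along a flag inclusion can be read
  off from ranks alone.\<close>

lemma flag_le:
  assumes "flag C" "F \<in> C" "G \<in> C" "rk F \<le> rk G"
  shows "F \<subseteq> G"
proof (rule ccontr)
  assume "\<not> F \<subseteq> G"
  then have "G \<subset> F" using assms by (auto simp: subset_chain_def)
  moreover have "F \<in> flats E indep" "G \<in> flats E indep"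
    using assms V_flat by (auto simp: subset_chain_def)
  ultimately show False
    using rk_flat_strict_mono[of G F] assms(4) flat_subset_ground[of F] by simp
qed

lemma flag_inj: "flag C \<Longrightarrow> inj_on rk C"
  by (rule inj_onI) (simp add: flag_le order_antisym)

lemma flag_rk_image: "flag C \<Longrightarrow> rk ` C \<subseteq> {1..d}"
  by (force simp: subset_chain_def V_iff)

lemma flag_card_le: "flag C \<Longrightarrow> card C \<le> d"
  using card_mono[OF _ flag_rk_image] card_image[OF flag_inj] by fastforce

lemma flag_card_eq_iff: "flag C \<Longrightarrow> card C = d \<longleftrightarrow> rk ` C = {1..d}"
  using card_image[OF flag_inj, of C] flag_rk_image[of C] card_subset_eq[of "{1..d}" "rk ` C"]
  by auto

text \<open>The flats \<open>A\<close> and \<open>B\<close> are the neighbours of the missing rank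
  \<open>i\<close> in the flag, with \<open>{}\<close> and \<open>E\<close> adjoined as end points
  so that gaps at the bottom and at the top are treated like all others.\<close>

lemma flag_gap:
  assumes "flag C" "i \<in> {1..d}" "i \<notin> rk ` C"
  obtains A B where "A \<in> insert {} C" "B \<in> insert E C" "A \<in> flats E indep" "B \<in> flats E indep"
    "A \<subseteq> B" "rk A < i" "i < rk B"
    "\<And>F. F \<in> C \<Longrightarrow> rk F < i \<Longrightarrow> F \<subseteq> A" "\<And>F. F \<in> C \<Longrightarrow> i < rk F \<Longrightarrow> B \<subseteq> F"
proof -
  define L where "L = insert {} {F\<in>C. rk F < i}"
  define U where "U = insert E {F\<in>C. i < rk F}"
  define A where "A = \<Union> L"
  define B where "B = \<Inter> U"
  have fl: "F \<in> flats E indep" if "F \<in> C" for F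
    using that V_flat flag_mem_V[OF assms(1)] by blast
  note tot = flag_total[OF assms(1)]
  have "subset.chain UNIV L" unfolding subset_chain_def L_def using tot by blast
  moreover have "subset.chain UNIV U"
    unfolding subset_chain_def U_def using tot fl flat_subset_ground by blast
  moreover have "finite L" "finite U"
    using flag_finite[OF assms(1)] by (auto simp: L_def U_def)
  moreover have "L \<noteq> {}" "U \<noteq> {}" by (auto simp: L_def U_def)
  ultimately have "A \<in> L" "B \<in> U"
    unfolding A_def B_def using Union_in_chain Inter_in_chain by blast+
  then have A: "A = {} \<or> A \<in> C \<and> rk A < i" and B: "B = E \<or> B \<in> C \<and> i < rk B"
    by (auto simp: L_def U_def)
  show thesis
  proof (rule that[of A B])
    show "A \<in> insert {} C" "B \<in> insert E C" using A B by auto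
    show "A \<in> flats E indep" "B \<in> flats E indep"
      using A B fl empty_flat ground_flat by auto
    show "rk A < i" "i < rk B" using A B assms(2) rk_ground by auto
    show "F \<subseteq> A" if "F \<in> C" "rk F < i" for F using that by (auto simp: L_def A_def)
    show "B \<subseteq> F" if "F \<in> C" "i < rk F" for F using that by (auto simp: U_def B_def)
    show "A \<subseteq> B"
      using A B fl flat_subset_ground[of A] flag_le[OF assms(1), of A B] by auto
  qed
qed

lemma flag_insert_between:
  assumes "flag C" "H \<in> V"
    and "\<And>F. F \<in> C \<Longrightarrow> F \<subseteq> H \<or> H \<subseteq> F"
  shows "flag (insert H C)"
  using assms unfolding subset_chain_def by blast

lemma flag_extend_step:
  assumes "flag C" "i \<in> {1..d}" "i \<notin> rk ` C"
  obtains H where "flag (insert H C)" "rk H = i"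
proof (rule flag_gap[OF assms])
  fix A B assume *: "A \<in> flats E indep" "B \<in> flats E indep" "A \<subseteq> B" "rk A < i" "i < rk B"
    "\<And>F. F \<in> C \<Longrightarrow> rk F < i \<Longrightarrow> F \<subseteq> A" "\<And>F. F \<in> C \<Longrightarrow> i < rk F \<Longrightarrow> B \<subseteq> F"
  obtain H where H: "H \<in> flats E indep" "A \<subseteq> H" "H \<subseteq> B" "rk H = i"
    by (rule intermediate_flat[of A B i]) (use * in auto)
  have "F \<subseteq> H \<or> H \<subseteq> F" if "F \<in> C" for F
  proof -
    have "rk F \<noteq> i" using assms(3) that by auto
    then show ?thesis using *(6,7)[OF that] H by (meson linorder_neqE_nat order_trans)
  qed
  then have "flag (insert H C)"
    using assms H by (intro flag_insert_between) (auto simp: V_iff)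
  then show thesis using that H by blast
qed

lemma flag_card_less:
  assumes "flag C" "card C < d"
  obtains H where "flag (insert H C)" "H \<notin> C"
proof -
  have "rk ` C \<noteq> {1..d}" using flag_card_eq_iff[OF assms(1)] assms(2) by auto
  then obtain i where i: "i \<in> {1..d}" "i \<notin> rk ` C" using flag_rk_image[OF assms(1)] by blast
  then show thesis using flag_extend_step[OF assms(1) i] that by blast
qed

text \<open>Purity of the Bergman fan: a missing rank can always be filled by a flat between its two
  neighbours, so a flag is maximal exactly if it meets each of the ranks from 1 to
  \<open>d\<close>.\<close>

lemma maxflag_iff: "maxflag C \<longleftrightarrow> flag C \<and> card C = d"
proof
  assume C: "maxflag C"
  then have ch: "flag C" by (rule subset.maxchain_imp_chain)
  have "\<not> card C < d"
  proof
    assume "card C < d"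
    then obtain H where "flag (insert H C)" "H \<notin> C" by (rule flag_card_less[OF ch])
    then show False using C by (auto simp: subset.maxchain_def)
  qed
  then show "flag C \<and> card C = d" using ch flag_card_le[OF ch] by auto
next
  assume C: "flag C \<and> card C = d"
  have "\<not> C \<subset> S" if "flag S" for S
    using psubset_card_mono[OF flag_finite[OF that], of C] flag_card_le[OF that] C by auto
  then show "maxflag C" using C by (auto simp: subset.maxchain_def)
qed

lemma flag_extend:
  assumes "flag C"
  obtains M where "maxflag M" "C \<subseteq> M"
proof -
  have "\<exists>M. maxflag M \<and> C \<subseteq> M"
    using assms
  proof (induction "d - card C" arbitrary: C)
    case 0
    then show ?case using flag_card_le[of C] maxflag_iff by auto
  next
    case (Suc k)
    then have "card C < d" by simp
    then obtain H where H: "flag (insert H C)" "H \<notin> C" using flag_card_less[OF Suc.prems] by blast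
    have "card (insert H C) = Suc (card C)" using H flag_finite[OF Suc.prems] by simp
    then have "k = d - card (insert H C)" using Suc.hyps(2) by simp
    then obtain M where "maxflag M" "insert H C \<subseteq> M" using Suc.hyps(1) H(1) by blast
    then show ?case by blast
  qed
  then show thesis using that by blast
qed

lemma maxflag_rank:
  assumes "maxflag C" "1 \<le> i" "i \<le> d"
  obtains F where "F \<in> C" "rk F = i"
proof -
  have "rk ` C = {1..d}" using assms(1) flag_card_eq_iff maxflag_iff by blast
  then have "i \<in> rk ` C" using assms by auto
  then show thesis using that by auto
qed

text \<open>Describes the star of a cone of codimension one. A single rank is missing, and the flats
  that complete the flag are those strictly inside the rank two interval between the neighbours of
  the gap.\<close>

lemma corank_one_flag:
  assumes "flag C" "card C + 1 = d"
  obtains A B where "A \<in> insert {} C" "B \<in> insert E C" "A \<in> flats E indep" "B \<in> flats E indep"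
    "A \<subseteq> B" "rk B = rk A + 2"
    "\<And>H. H \<in> V \<Longrightarrow> H \<notin> C \<and> flag (insert H C) \<longleftrightarrow> A \<subseteq> H \<and> H \<subseteq> B \<and> rk H = Suc (rk A)"
proof -
  have "card (rk ` C) = card C" by (rule card_image[OF flag_inj[OF assms(1)]])
  moreover have "card ({1..d} - rk ` C) = d - card (rk ` C)"
    using flag_rk_image[OF assms(1)] flag_finite[OF assms(1)] by (simp add: card_Diff_subset)
  ultimately have "card ({1..d} - rk ` C) = 1" using assms(2) by simp
  then obtain i where i: "{1..d} - rk ` C = {i}" by (rule card_1_singletonE)
  then have iC: "i \<in> {1..d}" "i \<notin> rk ` C" by blast+
  have hit: "j \<in> rk ` C" if "j \<in> {1..d}" "j \<noteq> i" for j
  proof (rule ccontr)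
    assume "j \<notin> rk ` C"
    then have "j \<in> {1..d} - rk ` C" using that(1) by (rule DiffI[rotated])
    then show False using that(2) unfolding i by simp
  qed
  show thesis
  proof (rule flag_gap[OF assms(1) iC])
    fix A B
    assume AB: "A \<in> insert {} C" "B \<in> insert E C" "A \<in> flats E indep" "B \<in> flats E indep"
      "A \<subseteq> B" "rk A < i" "i < rk B"
      and le: "\<And>F. F \<in> C \<Longrightarrow> rk F < i \<Longrightarrow> F \<subseteq> A" "\<And>F. F \<in> C \<Longrightarrow> i < rk F \<Longrightarrow> B \<subseteq> F"
    \<comment> \<open>Every rank from 1 to \<open>d\<close> other than \<open>i\<close> occurs in
      the flag, so the neighbours have ranks \<open>i - 1\<close> and \<open>i + 1\<close>; at the
      two ends these are the ranks 0 and \<open>d + 1\<close> of \<open>{}\<close> and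
      \<open>E\<close>.\<close>
    have rkA: "i \<le> Suc (rk A)"
    proof (cases "i = 1")
      case False
      then have "i - 1 \<in> rk ` C" using iC(1) by (intro hit) auto
      then obtain F where F: "F \<in> C" "rk F = i - 1" by force
      then have "F \<subseteq> A" using iC(1) by (intro le(1)) auto
      then show ?thesis using rk_mono[of F A] F(2) by simp
    qed simp
    have rkB: "rk B \<le> Suc i"
    proof (cases "i = d")
      case True
      then show ?thesis using rk_mono[OF flat_subset_ground[OF AB(4)]] rk_ground by simp
    next
      case False
      then have "i + 1 \<in> rk ` C" using iC(1) by (intro hit) auto
      then obtain F where F: "F \<in> C" "rk F = i + 1" by force
      then have "B \<subseteq> F" by (intro le(2)) auto
      then show ?thesis using rk_mono[of B F] F(2) by simp
    qed
    have iA: "i = Suc (rk A)" and iB: "rk B = Suc i" using rkA rkB AB(6,7) by auto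
    show thesis
    proof (rule that[OF AB(1-5)])
      show "rk B = rk A + 2" using iA iB by simp
      fix H assume H: "H \<in> V"
      show "H \<notin> C \<and> flag (insert H C) \<longleftrightarrow> A \<subseteq> H \<and> H \<subseteq> B \<and> rk H = Suc (rk A)"
      proof (intro iffI conjI)
        assume *: "H \<notin> C \<and> flag (insert H C)"
        then have "rk H \<notin> rk ` C" using flag_inj[of "insert H C"] by simp
        moreover have "rk H \<in> {1..d}" using H by (simp add: V_iff)
        ultimately show rkH: "rk H = Suc (rk A)" using i iA by blast
        have ch: "flag (insert H C)" using * by blast
        show "A \<subseteq> H" using flag_le[OF ch, of A H] AB(1) rkH by auto
        show "H \<subseteq> B"
          using flag_le[OF ch, of H B] AB(2) rkH iA iB flat_subset_ground[OF V_flat[OF H]] by auto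
      next
        assume *: "A \<subseteq> H \<and> H \<subseteq> B \<and> rk H = Suc (rk A)"
        then show "H \<notin> C" using iC(2) iA by force
        have "F \<subseteq> H \<or> H \<subseteq> F" if "F \<in> C" for F
        proof -
          have "rk F \<noteq> i" using iC that by auto
          then show ?thesis using le[OF that] * by (meson linorder_neqE_nat order_trans)
        qed
        then show "flag (insert H C)" by (rule flag_insert_between[OF assms(1) H])
      qed
    qed
  qed
qed

text \<open>The flats covering \<open>A\<close> partition the complement of \<open>A\<close>, so the rays of the maximal cones
  around a codimension one cone add up to an element of its span.\<close>

lemma corank_one_balanced:
  fixes c :: "'a \<Rightarrow> real"
  assumes "flag C" "card C + 1 = d" "sum c E = 0" "\<And>F. F \<in> C \<Longrightarrow> sum c F = 0"
  shows "(\<Sum>H\<in>{H\<in>V. H \<notin> C \<and> flag (insert H C)}. sum c H) = 0"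
proof -
  obtain A B where AB: "A \<in> insert {} C" "B \<in> insert E C" "A \<in> flats E indep" "B \<in> flats E indep"
    "A \<subseteq> B" "rk B = rk A + 2"
    and iff: "\<And>H. H \<in> V \<Longrightarrow> H \<notin> C \<and> flag (insert H C) \<longleftrightarrow> A \<subseteq> H \<and> H \<subseteq> B \<and> rk H = Suc (rk A)"
    by (rule corank_one_flag[OF assms(1,2)], rule that, assumption+)
  define S where "S = {H\<in>V. H \<notin> C \<and> flag (insert H C)}"
  have S: "H \<in> flats E indep" "A \<subseteq> H" "H \<subseteq> B" "rk H = Suc (rk A)" if "H \<in> S" for H
    using that iff V_flat by (auto simp: S_def)
  have rkB: "rk B \<le> d + 1" using rk_mono[of B E] AB rk_ground flat_subset_ground by auto
  have cover: "(\<Union>H\<in>S. H - A) = B - A"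
  proof (intro equalityI subsetI)
    fix x assume x: "x \<in> B - A"
    then have xE: "x \<in> E - A" using AB flat_subset_ground by auto
    have "cl (insert x A) \<subseteq> B" using x AB by (intro closure_least) auto
    moreover have "cl (insert x A) \<in> V"
      using cover_flat[OF AB(3) xE] AB rkB by (simp add: V_iff)
    ultimately have "cl (insert x A) \<in> S"
      using cover_flat[OF AB(3) xE] iff by (auto simp: S_def)
    then show "x \<in> (\<Union>H\<in>S. H - A)" using x cover_flat[OF AB(3) xE] by auto
  qed (use S in blast)
  have fin: "finite S" "\<And>H. H \<in> S \<Longrightarrow> finite H"
    using finite_V finite_V_mem by (auto simp: S_def)
  have finB: "finite B" using AB(4) flat_subset_ground finite_ground finite_subset by blast
  \<comment> \<open>Both ends of the interval are trivial flats or members of \<open>C\<close>, and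
    \<open>c\<close> sums to zero on each of these.\<close>
  have A0: "sum c A = 0" and B0: "sum c B = 0" using assms AB(1,2) by auto
  have disj: "(H - A) \<inter> (H' - A) = {}" if "H \<in> S" "H' \<in> S" "H \<noteq> H'" for H H'
    using cover_unique[OF AB(3), of H] cover_unique[OF AB(3), of H'] S that by blast
  have "(\<Sum>H\<in>S. sum c H) = (\<Sum>H\<in>S. sum c (H - A))"
    by (rule sum.cong) (use S fin A0 in \<open>auto simp: sum_diff\<close>)
  also have "\<dots> = sum c (\<Union>H\<in>S. H - A)"
    by (rule sum.UNION_disjoint[symmetric]) (use fin disj in auto)
  also have "\<dots> = 0" using cover A0 B0 AB(5) finB by (simp add: sum_diff)
  finally show ?thesis by (simp add: S_def)
qed

text \<open>Maximal flags are connected through corank one: the second flag is approached from below,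
  replacing one flat at a time inside a rank two interval.\<close>

lemma maxflag_connected:
  assumes step: "\<And>C H H'. flag C \<Longrightarrow> H \<notin> C \<Longrightarrow> H' \<notin> C \<Longrightarrow> maxflag (insert H C) \<Longrightarrow>
      maxflag (insert H' C) \<Longrightarrow> P (insert H C) \<Longrightarrow> P (insert H' C)"
    and "maxflag S" "maxflag S'" "P S"
  shows "P S'"
proof -
  \<comment> \<open>The claim is strengthened by the rank \<open>k\<close> up to which the two flags
    agree, and the induction increases this rank.\<close>
  have "P S'" if "maxflag S" "maxflag S'" "P S" "{F\<in>S. rk F \<le> k} = {F\<in>S'. rk F \<le> k}" for k S S'
    using that
  proof (induction "d - k" arbitrary: k S S')
    case 0
    have "{F\<in>X. rk F \<le> k} = X" if X: "maxflag X" for X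
    proof -
      have "rk F \<le> k" if "F \<in> X" for F
      proof -
        have "rk F \<in> {1..d}" using flag_rk_image[of X] X that by (auto simp: maxflag_iff)
        then show ?thesis using 0(1) by simp
      qed
      then show ?thesis by blast
    qed
    from box_equals[OF 0(5) this[OF 0(2)] this[OF 0(3)]] show ?case
      using 0(4) by simp
  next
    case (Suc j)
    have flS: "flag S" and flS': "flag S'" using Suc.prems by (auto simp: maxflag_iff)
    obtain F where F: "F \<in> S" "rk F = Suc k"
      by (rule maxflag_rank[OF Suc.prems(1), of "Suc k"]) (use Suc.hyps(2) in auto)
    obtain F' where F': "F' \<in> S'" "rk F' = Suc k"
      by (rule maxflag_rank[OF Suc.prems(2), of "Suc k"]) (use Suc.hyps(2) in auto)
    define L where "L = {F\<in>S. rk F \<le> k}"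
    have agree: "{G\<in>X. rk G \<le> Suc k} = insert H L"
      if "flag X" "L = {F\<in>X. rk F \<le> k}" "H \<in> X" "rk H = Suc k" for X H
    proof -
      have "G = H" if "G \<in> X" "rk G = Suc k" for G
        by (rule inj_onD[OF flag_inj[OF \<open>flag X\<close>]]) (use that \<open>H \<in> X\<close> \<open>rk H = Suc k\<close> in auto)
      then show ?thesis unfolding that(2) le_Suc_eq using that(3,4) by blast
    qed
    have IH: "P Y" if "maxflag X" "maxflag Y" "P X"
      "{G\<in>X. rk G \<le> Suc k} = {G\<in>Y. rk G \<le> Suc k}" for X Y
      by (rule Suc.hyps(1)[of "Suc k" X Y]) (use Suc.hyps(2) that in auto)
    show ?case
    proof (cases "F = F'")
      case True
      then show ?thesis
        using IH[OF Suc.prems(1-3)] agree[OF flS _ F] agree[OF flS' _ F'] Suc.prems(4)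
        by (simp add: L_def)
    next
      case False
      have FF': "F \<in> V" "F' \<in> V" using F F' flag_mem_V[OF flS] flag_mem_V[OF flS'] by auto
      obtain A where A: "A \<in> insert {} L" "rk A = k"
      proof (cases "k = 0")
        case True
        then show thesis using that[of "{}"] by simp
      next
        case k: False
        obtain A where "A \<in> S" "rk A = k"
          by (rule maxflag_rank[OF Suc.prems(1), of k]) (use k Suc.hyps(2) in auto)
        then show thesis using that[of A] by (auto simp: L_def)
      qed
      have LS': "L = {F\<in>S'. rk F \<le> k}" using Suc.prems(4) by (simp add: L_def)
      have A': "A \<in> flats E indep" "A \<subseteq> F" "A \<subseteq> F'"
        using A empty_flat flag_le[OF flS, of A F] flag_le[OF flS', of A F'] F F'
          V_flat[OF flag_mem_V[OF flS]] LS'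
        by (auto simp: L_def)
      have "\<not> F' \<subseteq> F"
        using flat_eqI[OF V_flat[OF FF'(2)] V_flat[OF FF'(1)]] F F' False by auto
      then obtain b where b: "b \<in> F' - F" by blast
      have bE: "b \<in> E - F" using b FF' V_flat flat_subset_ground by auto
      \<comment> \<open>The join of \<open>F\<close> and \<open>F'\<close>. It is the upper end of
        the rank two interval above \<open>A\<close> in which \<open>F\<close> is exchanged for
        \<open>F'\<close>.\<close>
      define K where "K = cl (insert b F)"
      have K: "K \<in> flats E indep" "rk K = k + 2" "F \<subseteq> K"
        using cover_flat[OF V_flat[OF FF'(1)] bE] F by (auto simp: K_def)
      have "F' = cl (insert b A)"
        using FF' V_flat A A' b F' by (intro cover_unique) auto
      also have "\<dots> \<subseteq> K"
        using K A' cover_flat[OF V_flat[OF FF'(1)] bE] by (intro closure_least) (auto simp: K_def)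
      finally have F'K: "F' \<subseteq> K" .
      have KE: "K = E \<or> K \<in> V"
        using K flat_top_rank[of K] Suc.hyps(2) by (auto simp: V_iff)
      \<comment> \<open>When the join is all of \<open>E\<close> it is not a nontrivial flat and is
        left out; \<open>F\<close> then already has the top rank \<open>d\<close>.\<close>
      define C where "C = insert F L \<union> ({K} - {E})"
      have FL: "flag (insert F L)" by (rule flag_subset[OF flS]) (use F in \<open>auto simp: L_def\<close>)
      have leK: "G \<subseteq> K" if "G \<in> insert F L" for G
        using that flag_le[OF flS, of G F] F K(3) by (cases "G = F") (auto simp: L_def)
      have "flag C"
      proof (cases "K = E")
        case True
        then show ?thesis using FL by (simp add: C_def)
      next
        case False
        then have "C = insert K (insert F L)" by (auto simp: C_def)
        moreover have "flag (insert K (insert F L))"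
          by (rule flag_insert_between[OF FL]) (use KE False leK in auto)
        ultimately show ?thesis by simp
      qed
      then obtain S1 where S1: "maxflag S1" "C \<subseteq> S1" using flag_extend by blast
      have flS1: "flag S1" using S1 by (simp add: maxflag_iff)
      have FS1: "F \<in> S1" "L \<subseteq> S1" using S1(2) by (auto simp: C_def)
      have "{G\<in>S1. rk G \<le> k} \<subseteq> L"
      proof
        fix G assume G: "G \<in> {G\<in>S1. rk G \<le> k}"
        have "1 \<le> rk G" "rk G \<le> d" using G flag_mem_V[OF flS1, of G] by (auto simp: V_iff)
        then obtain G' where G': "G' \<in> S" "rk G' = rk G"
          using maxflag_rank[OF Suc.prems(1) \<open>1 \<le> rk G\<close>] \<open>rk G \<le> d\<close> by blast
        then have "G' \<in> L" using G by (auto simp: L_def)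
        then show "G \<in> L" using inj_onD[OF flag_inj[OF flS1] G'(2)] FS1 G by auto
      qed
      then have LS1: "L = {G\<in>S1. rk G \<le> k}" using FS1 by (auto simp: L_def)
      have comp: "G \<subseteq> F' \<or> F' \<subseteq> G" if G: "G \<in> S1 - {F}" for G
      proof -
        have "rk G \<noteq> Suc k" using inj_onD[OF flag_inj[OF flS1], of G F] G FS1 F by auto
        then consider "rk G \<le> k" | "k + 2 \<le> rk G" by linarith
        then show ?thesis
        proof cases
          case 1
          then have "G \<in> S'" using G LS1 LS' by blast
          then show ?thesis using flag_le[OF flS' _ F'(1)] 1 F' by auto
        next
          case 2
          have "G \<in> V" using G flag_mem_V[OF flS1] by auto
          then have "K \<noteq> E" using K 2 rk_ground by (auto simp: V_iff)
          then have "K \<in> S1" using S1(2) by (auto simp: C_def)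
          then have "K \<subseteq> G" using flag_le[OF flS1, of K G] G K 2 by auto
          then show ?thesis using F'K by auto
        qed
      qed
      define S2 where "S2 = insert F' (S1 - {F})"
      have F'S1: "F' \<notin> S1 - {F}"
        using inj_onD[OF flag_inj[OF flS1], of F' F] FS1 F F' False by auto
      have flS1F: "flag (S1 - {F})" by (rule flag_subset[OF flS1]) auto
      have "flag S2" unfolding S2_def using flS1F FF' comp by (intro flag_insert_between) auto
      moreover have "card S2 = card S1"
        unfolding S2_def card.remove[OF flag_finite[OF flS1] FS1(1)]
        using F'S1 flag_finite[OF flS1F] by (rule card_insert_disjoint[rotated])
      ultimately have S2: "maxflag S2" using S1(1) by (simp add: maxflag_iff)
      \<comment> \<open>Up to rank \<open>Suc k\<close> the flag \<open>S1\<close> agrees with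
        \<open>S\<close>, and \<open>S2\<close> agrees with \<open>S'\<close>. The induction
        hypothesis covers both of these passages, and only the exchange of \<open>F\<close> for
        \<open>F'\<close> between \<open>S1\<close> and \<open>S2\<close> uses
        \<open>step\<close>.\<close>
      have "P S1"
        using IH[OF Suc.prems(1) S1(1) Suc.prems(3)] agree[OF flS L_def F] agree[OF flS1 LS1 FS1(1) F(2)]
        by simp
      then have "P S2"
        using step[OF flS1F _ F'S1, of F] S1(1) S2 FS1(1) by (simp add: S2_def insert_absorb)
      moreover have "L = {G\<in>S2. rk G \<le> k}"
        using LS1 F F' by (auto simp: S2_def)
      then have "{G\<in>S2. rk G \<le> Suc k} = insert F' L"
        using agree[OF \<open>flag S2\<close>, of F'] F' by (simp add: S2_def)
      ultimately show ?thesis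
        using IH[OF S2 Suc.prems(2)] agree[OF flS' LS' F'] by simp
    qed
  qed
  note main = this
  have empty: "{F\<in>X. rk F \<le> 0} = {}" if "maxflag X" for X
    using flag_rk_image[of X] that by (force simp: maxflag_iff)
  show ?thesis
    by (rule main[OF assms(2-4), of 0]) (simp only: empty[OF assms(2)] empty[OF assms(3)])
qed

end

section \<open>The determinants\<close>

text \<open>The coefficient \<open>a_j\<close> as a real cofactor. The first row is filled with 0
  because a cofactor along that row does not see its entries.\<close>

definition ray_coeff :: "nat \<Rightarrow> ('a \<Rightarrow> real vec) \<Rightarrow> 'a set list \<Rightarrow> nat \<Rightarrow> real" where
  "ray_coeff d v Fs j =
     cofactor (mat d d (\<lambda>(r, j). if r = 0 then 0 else vec_sum (d - 1) v (Fs ! j) $ (r - 1))) 0 j"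

lemma cofactor_first_row:
  assumes "j < d"
  shows "cofactor (mat d d (\<lambda>(r, j). if r = 0 then g j else h r j)) 0 j =
    cofactor (mat d d (\<lambda>(r, j). if r = 0 then g' j else h r j)) 0 j"
proof -
  have "mat_delete (mat d d (\<lambda>(r, j). if r = 0 then g j else h r j)) 0 j =
      mat_delete (mat d d (\<lambda>(r, j). if r = 0 then g' j else h r j)) 0 j"
    using assms by (intro eq_matI) (auto simp: mat_delete_def)
  then show ?thesis by (simp add: cofactor_def)
qed

lemma det_hat_matrix:
  assumes "d \<ge> 1"
  shows "det (hat_matrix d v Fs) = (\<Sum>j<d. PConst (ray_coeff d v Fs j) * PVar (Fs ! j))"
proof -
  interpret comm_ring_hom PConst by (rule PConst_hom)
  let ?h = "\<lambda>r j. vec_sum (d - 1) v (Fs ! j) $ (r - 1)"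
  have cof: "cofactor (hat_matrix d v Fs) 0 j = PConst (ray_coeff d v Fs j)" if "j < d" for j
  proof -
    have "mat_delete (hat_matrix d v Fs) 0 j =
        map_mat PConst (mat_delete (mat d d (\<lambda>(r, j). if r = 0 then 0 else ?h r j)) 0 j)"
      using that by (intro eq_matI) (auto simp: mat_delete_def hat_matrix_def)
    then show ?thesis
      by (simp add: cofactor_def ray_coeff_def hom_distribs)
  qed
  have "det (hat_matrix d v Fs) =
      (\<Sum>j<d. hat_matrix d v Fs $$ (0, j) * cofactor (hat_matrix d v Fs) 0 j)"
    by (rule laplace_expansion_row) (use assms in \<open>auto simp: hat_matrix_def\<close>)
  also have "\<dots> = (\<Sum>j<d. PConst (ray_coeff d v Fs j) * PVar (Fs ! j))"
    by (rule sum.cong) (use assms in \<open>auto simp: cof mult.commute\<close>, auto simp: hat_matrix_def)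
  finally show ?thesis .
qed

lemma chain_coeff_eq:
  assumes "d \<ge> 1" "distinct Fs" "length Fs = d" "j < d"
  shows "chain_coeff d v Fs j = ray_coeff d v Fs j"
proof -
  have *: "lookup (PVar F) (single G 1) = (if F = G then 1 else 0)" for F G :: "'a set"
  proof -
    have "single F (1::nat) = single G 1 \<longleftrightarrow> F = G"
      by (metis keys_single one_neq_zero singleton_inject)
    then show ?thesis by (simp add: PVar_def lookup_single when_def)
  qed
  have "chain_coeff d v Fs j = (\<Sum>i<d. ray_coeff d v Fs i * (if Fs ! i = Fs ! j then 1 else 0))"
    unfolding chain_coeff_def det_hat_matrix[OF assms(1)] lookup_sum lookup_PConst_times * ..
  also have "\<dots> = (\<Sum>i<d. if i = j then ray_coeff d v Fs i else 0)"
    by (rule sum.cong) (use assms in \<open>auto simp: nth_eq_iff_index_eq\<close>)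
  also have "\<dots> = ray_coeff d v Fs j" using assms(4) by simp
  finally show ?thesis .
qed

text \<open>The sum is the expansion along the first row of a determinant whose first row repeats
  one of the rows below it. This is the linear relation between the vectors of a maximal
  chain.\<close>

lemma ray_coeff_relation:
  assumes "r < d - 1"
  shows "(\<Sum>j<d. ray_coeff d v Fs j * vec_sum (d - 1) v (Fs ! j) $ r) = 0"
proof -
  let ?h = "\<lambda>r j. vec_sum (d - 1) v (Fs ! j) $ (r - 1)"
  let ?M = "mat d d (\<lambda>(r', j). if r' = 0 then ?h (Suc r) j else ?h r' j)"
  have "det ?M = (\<Sum>j<d. ?M $$ (0, j) * cofactor ?M 0 j)"
    by (rule laplace_expansion_row) (use assms in auto)
  also have "\<dots> = (\<Sum>j<d. ray_coeff d v Fs j * vec_sum (d - 1) v (Fs ! j) $ r)"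
  proof (rule sum.cong[OF refl])
    fix j assume j: "j \<in> {..<d}"
    have "cofactor ?M 0 j = ray_coeff d v Fs j"
      unfolding ray_coeff_def using j by (intro cofactor_first_row) auto
    then show "?M $$ (0, j) * cofactor ?M 0 j = ray_coeff d v Fs j * vec_sum (d - 1) v (Fs ! j) $ r"
      using j by simp
  qed
  also have "det ?M = 0"
    by (rule det_identical_rows[of _ d 0 "Suc r"]) (use assms in \<open>auto intro!: eq_vecI\<close>)
  finally show ?thesis by simp
qed

text \<open>A nonzero cofactor at \<open>j0\<close> says that the vectors at the other
  \<open>d - 1\<close> positions form a basis. The numbers \<open>w\<close> are the member of the
  dual basis that belongs to \<open>j1\<close>; the value at \<open>j0\<close> is left open.\<close>

lemma ray_coeff_dual:
  assumes "ray_coeff d v Fs j0 \<noteq> 0" "j0 < d" "j1 < d" "j1 \<noteq> j0"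
  obtains w :: "nat \<Rightarrow> real" where
    "(\<Sum>r<d-1. w r * vec_sum (d - 1) v (Fs ! j1) $ r) = 1"
    "\<And>j. j < d \<Longrightarrow> j \<noteq> j0 \<Longrightarrow> j \<noteq> j1 \<Longrightarrow> (\<Sum>r<d-1. w r * vec_sum (d - 1) v (Fs ! j) $ r) = 0"
proof -
  define M where "M = mat d d (\<lambda>(r, j). if r = 0 then 0 else vec_sum (d - 1) v (Fs ! j) $ (r - 1))"
  define N where "N = mat_delete M 0 j0"
  have N: "N \<in> carrier_mat (d - 1) (d - 1)"
    unfolding N_def by (rule mat_delete_carrier) (simp add: M_def)
  have "det N \<noteq> 0" using assms(1) by (simp add: ray_coeff_def cofactor_def N_def M_def)
  have entry: "N $$ (r, delete_index j0 j) = vec_sum (d - 1) v (Fs ! j) $ r"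
    and small: "delete_index j0 j < d - 1"
    if "r < d - 1" "j < d" "j \<noteq> j0" for r j
    using that assms(2) by (auto simp: N_def M_def mat_delete_def delete_index_def)
  \<comment> \<open>A row of the inverse of the minor \<open>N\<close>, written with the adjugate;
    \<open>delete_index\<close> gives the column numbers after column \<open>j0\<close> has been
    removed.\<close>
  define w where "w r = adj_mat N $$ (delete_index j0 j1, r) / det N" for r
  have sum: "(\<Sum>r<d-1. w r * vec_sum (d - 1) v (Fs ! j) $ r) = (if j = j1 then 1 else 0)"
    if j: "j < d" "j \<noteq> j0" for j
  proof -
    have pos: "0 < d - 1" using assms by linarith
    have del_eq: "delete_index j0 j1 = delete_index j0 j \<longleftrightarrow> j = j1"
      using insert_delete_index[of j j0] insert_delete_index[of j1 j0] j assms(4) by metis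
    have "(\<Sum>r<d-1. w r * vec_sum (d - 1) v (Fs ! j) $ r) =
        (\<Sum>r<d-1. adj_mat N $$ (delete_index j0 j1, r) * N $$ (r, delete_index j0 j)) / det N"
      unfolding sum_divide_distrib by (rule sum.cong) (use j in \<open>auto simp: w_def entry\<close>)
    also have "\<dots> = (adj_mat N * N) $$ (delete_index j0 j1, delete_index j0 j) / det N"
      using N adj_mat(1)[OF N] small[OF pos] j assms(3,4)
      by (simp add: times_mat_def scalar_prod_def atLeast0LessThan)
    also have "\<dots> = (if j = j1 then 1 else 0)"
      unfolding adj_mat(3)[OF N] using small[OF pos] j assms(3,4) \<open>det N \<noteq> 0\<close> del_eq by simp
    finally show ?thesis .
  qed
  show thesis
    by (rule that[of w]) (use sum assms in auto)
qed

lemma vec_sum_index: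
  assumes "finite F" "\<And>i. i \<in> F \<Longrightarrow> v i \<in> carrier_vec m" "r < m"
  shows "vec_sum m v F $ r = (\<Sum>i\<in>F. v i $ r)"
  unfolding vec_sum_def by (rule index_finsum_vec) (use assms in auto)

section \<open>Maximal chains as lists\<close>

lemma sorted_wrt_psubset_distinct: "sorted_wrt (\<subset>) Fs \<Longrightarrow> distinct Fs"
  by (induction Fs) auto

text \<open>Makes the list of a chain a function of its set, so that the sum over lists counts each
  maximal flag once.\<close>

lemma sorted_wrt_psubset_unique:
  assumes "sorted_wrt (\<subset>) xs" "sorted_wrt (\<subset>) ys" "set xs = set ys"
  shows "xs = ys"
  using assms
proof (induction xs arbitrary: ys)
  case Nil
  then show ?case by simp
next
  case (Cons x xs)
  from Cons.prems(3) obtain y ys' where ys: "ys = y # ys'" by (cases ys) auto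
  have x: "\<forall>z\<in>set xs. x \<subset> z" "sorted_wrt (\<subset>) xs" using Cons.prems(1) by auto
  have y: "\<forall>z\<in>set ys'. y \<subset> z" "sorted_wrt (\<subset>) ys'" using Cons.prems(2) ys by auto
  have eq: "insert x (set xs) = insert y (set ys')" using Cons.prems(3) ys by simp
  have xy: "x = y"
  proof (rule ccontr)
    assume "x \<noteq> y"
    then have "x \<in> set ys'" "y \<in> set xs" using eq by blast+
    then show False using x(1) y(1) by blast
  qed
  have "y \<notin> set xs" "y \<notin> set ys'" using x(1) y(1) xy by blast+
  then have "set xs = set ys'" using eq insert_ident unfolding xy by metis
  then have "xs = ys'" by (rule Cons.IH[OF x(2) y(2)])
  then show ?case using xy ys by simp
qed

lemma chain_sorted_list:
  assumes "finite S" "\<And>X Y. X \<in> S \<Longrightarrow> Y \<in> S \<Longrightarrow> X \<subseteq> Y \<or> Y \<subseteq> X"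
  obtains xs where "sorted_wrt (\<subset>) xs" "set xs = S"
proof -
  have "\<exists>xs. sorted_wrt (\<subset>) xs \<and> set xs = S"
    using assms
  proof (induction "card S" arbitrary: S)
    case 0
    then show ?case by (intro exI[of _ "[]"]) simp
  next
    case (Suc n)
    have "subset.chain UNIV S" unfolding subset_chain_def using Suc.prems(2) by blast
    moreover have "S \<noteq> {}" using Suc.hyps(2) by auto
    ultimately have top: "\<Union>S \<in> S" using Union_in_chain[OF Suc.prems(1)] by blast
    have "n = card (S - {\<Union>S})" using Suc.hyps(2) Suc.prems(1) top by simp
    moreover have "finite (S - {\<Union>S})" using Suc.prems(1) by simp
    moreover have "X \<subseteq> Y \<or> Y \<subseteq> X" if "X \<in> S - {\<Union>S}" "Y \<in> S - {\<Union>S}" for X Y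
      using Suc.prems(2) that by blast
    ultimately obtain xs where xs: "sorted_wrt (\<subset>) xs" "set xs = S - {\<Union>S}"
      using Suc.hyps(1)[of "S - {\<Union>S}"] by blast
    have "sorted_wrt (\<subset>) (xs @ [\<Union>S])"
      unfolding sorted_wrt_append using xs by auto
    moreover have "set (xs @ [\<Union>S]) = S" using xs(2) top by auto
    ultimately show ?case by blast
  qed
  then show thesis using that by blast
qed

context loopless_matroid
begin

abbreviation MC where "MC \<equiv> maximal_chains E indep"

lemma MC_iff: "Fs \<in> MC \<longleftrightarrow> sorted_wrt (\<subset>) Fs \<and> maxflag (set Fs)"
  by (simp add: maximal_chains_def)

lemma MC_distinct: "Fs \<in> MC \<Longrightarrow> distinct Fs"
  by (simp add: MC_iff sorted_wrt_psubset_distinct)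

lemma MC_length: "Fs \<in> MC \<Longrightarrow> length Fs = d"
  using distinct_card[OF MC_distinct] by (simp add: MC_iff maxflag_iff)

lemma MC_subset: "Fs \<in> MC \<Longrightarrow> set Fs \<subseteq> V"
  by (auto simp: MC_iff maxflag_iff dest: flag_mem_V)

lemma MC_inj: "inj_on set MC"
  by (rule inj_onI) (simp add: MC_iff sorted_wrt_psubset_unique)

lemma finite_MC: "finite MC"
proof (rule inj_on_finite[OF MC_inj])
  show "set ` MC \<subseteq> Pow V" using MC_subset by blast
  show "finite (Pow V)" using finite_V by simp
qed

lemma MC_obtain:
  assumes "maxflag S"
  obtains Fs where "Fs \<in> MC" "set Fs = S"
proof -
  have S: "flag S" using assms by (simp add: maxflag_iff)
  obtain Fs where "sorted_wrt (\<subset>) Fs" "set Fs = S"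
    by (rule chain_sorted_list[OF flag_finite[OF S] flag_total[OF S]])
  then show thesis using that[of Fs] assms by (simp add: MC_iff)
qed

lemma ex_maxflag: obtains S where "maxflag S"
  using flag_extend[of "{}"] subset.chain_empty by blast

section \<open>The Chow ideal\<close>

abbreviation R where "R \<equiv> flat_poly_ring E indep"
abbreviation I where "I \<equiv> chow_ideal E indep"

lemma R_simps [simp]:
  "carrier R = polys_in V" "x \<otimes>\<^bsub>R\<^esub> y = x * y" "\<one>\<^bsub>R\<^esub> = 1" "\<zero>\<^bsub>R\<^esub> = 0" "x \<oplus>\<^bsub>R\<^esub> y = x + y"
  by (simp_all add: flat_poly_ring_def poly_ring_def)

lemma R_cring: "cring R"
  by (simp add: flat_poly_ring_def cring_poly_ring)

lemma R_ring: "ring R"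
  using R_cring by (rule cring.axioms(1))

lemma R_uminus [simp]:
  assumes "x \<in> polys_in V"
  shows "\<ominus>\<^bsub>R\<^esub> x = - x"
proof -
  interpret cring R by (rule R_cring)
  show ?thesis by (rule minus_equality) (use assms in auto)
qed

lemma R_minus [simp]: "x \<in> polys_in V \<Longrightarrow> y \<in> polys_in V \<Longrightarrow> x \<ominus>\<^bsub>R\<^esub> y = x - y"
  by (simp add: a_minus_def)

lemma gens_subset:
  "incomparable_gens E indep \<subseteq> polys_in V" "linear_gens E indep \<subseteq> polys_in V"
  by (auto simp: incomparable_gens_def linear_gens_def)

lemma I_ideal: "ideal I R"
  unfolding chow_ideal_def
  using gens_subset by (intro ring.add_ideals ring.genideal_ideal R_ring) auto

lemma I_0 [simp]: "0 \<in> I"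
  using additive_subgroup.zero_closed[OF ideal.axioms(1)[OF I_ideal]] by simp

lemma I_add: "p \<in> I \<Longrightarrow> q \<in> I \<Longrightarrow> p + q \<in> I"
  using additive_subgroup.a_closed[OF ideal.axioms(1)[OF I_ideal]] by simp

lemma I_mult: "p \<in> I \<Longrightarrow> r \<in> polys_in V \<Longrightarrow> r * p \<in> I"
  using ideal.I_l_closed[OF I_ideal] by simp

lemma I_uminus: "p \<in> I \<Longrightarrow> - p \<in> I"
  using I_mult[of p "- 1"] by simp

lemma I_diff: "p \<in> I \<Longrightarrow> q \<in> I \<Longrightarrow> p - q \<in> I"
  using I_add[of p "- q"] I_uminus[of q] by simp

lemma I_sum: "(\<And>i. i \<in> A \<Longrightarrow> f i \<in> I) \<Longrightarrow> sum f A \<in> I"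
  by (induction A rule: infinite_finite_induct) (auto intro: I_add)

lemma gens_in_I:
  assumes "p \<in> incomparable_gens E indep \<or> p \<in> linear_gens E indep"
  shows "p \<in> I"
proof -
  let ?A = "genideal R (incomparable_gens E indep)" and ?B = "genideal R (linear_gens E indep)"
  have id: "ideal ?A R" "ideal ?B R"
    using gens_subset by (intro ring.genideal_ideal R_ring; simp)+
  have "0 \<in> ?A" "0 \<in> ?B"
    using id[THEN ideal.axioms(1), THEN additive_subgroup.zero_closed] by simp_all
  moreover have "p \<in> ?A \<or> p \<in> ?B"
    using assms gens_subset ring.genideal_self[OF R_ring] by (metis R_simps(1) subsetD)
  ultimately show ?thesis
    unfolding chow_ideal_def set_add_def' by force
qed

text \<open>The way to show that a functional vanishes on the Chow ideal: it suffices to find one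
  ideal in its kernel that contains both kinds of generators.\<close>

lemma I_minimal:
  assumes "ideal K R" "incomparable_gens E indep \<subseteq> K" "linear_gens E indep \<subseteq> K"
  shows "I \<subseteq> K"
proof
  fix p assume "p \<in> I"
  then obtain a b where p: "a \<in> genideal R (incomparable_gens E indep)"
    "b \<in> genideal R (linear_gens E indep)" "p = a + b"
    unfolding chow_ideal_def set_add_def' by auto
  have "a \<in> K" using p(1) ring.genideal_minimal[OF R_ring assms(1,2)] by blast
  moreover have "b \<in> K" using p(2) ring.genideal_minimal[OF R_ring assms(1,3)] by blast
  ultimately show "p \<in> K"
    using p(3) additive_subgroup.a_closed[OF ideal.axioms(1)[OF assms(1)]] by simp
qed

lemma incomparable_product:
  fixes m :: "'a set \<Rightarrow>\<^sub>0 nat"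
  assumes "\<not> flag (keys m)" "keys m \<subseteq> V"
  obtains F G m' where "F \<in> V" "G \<in> V" "\<not> F \<subseteq> G" "\<not> G \<subseteq> F"
    "m = m' + (single F 1 + single G 1)"
proof -
  obtain F G where FG: "F \<in> keys m" "G \<in> keys m" "\<not> F \<subseteq> G" "\<not> G \<subseteq> F"
    using assms unfolding subset_chain_def by blast
  have "m = (m - (single F 1 + single G 1)) + (single F 1 + single G 1)"
    using FG by (intro poly_mapping_eqI)
      (auto simp: lookup_add lookup_minus lookup_single when_def in_keys_iff)
  then show thesis using that FG assms(2) by blast
qed

lemma nonflag_in_I:
  assumes "\<not> flag (keys m)" "keys m \<subseteq> V"
  shows "single m c \<in> I"
proof (rule incomparable_product[OF assms])
  fix F G m' assume FG: "F \<in> V" "G \<in> V" "\<not> F \<subseteq> G" "\<not> G \<subseteq> F"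
    "m = m' + (single F 1 + single G 1)"
  have "PVar F * PVar G \<in> I"
    by (rule gens_in_I) (use FG in \<open>auto simp: incomparable_gens_def\<close>)
  moreover have "keys m' \<subseteq> V" using assms(2) FG(5) by (simp add: keys_add_nat)
  ultimately have "single m' c * (PVar F * PVar G) \<in> I" by (rule I_mult[OF _ polys_in_single])
  then show ?thesis by (simp add: FG(5) PVar_def mult_single)
qed

lemma monomial_times_linear:
  "single m 1 * (\<Sum>H\<in>V. PConst (\<Sum>x\<in>H. c x) * PVar H) = (\<Sum>H\<in>V. single (m + single H 1) (sum c H))"
  by (simp add: sum_distrib_left PVar_def PConst_single mult_single)

lemma linear_in_I:
  assumes "sum c E = 0" "keys m \<subseteq> V"
  shows "(\<Sum>H\<in>V. single (m + single H 1) (sum c H)) \<in> I"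
  unfolding monomial_times_linear[symmetric]
  by (intro I_mult gens_in_I) (use assms in \<open>auto simp: linear_gens_def\<close>)

text \<open>With \<open>a\<close> in \<open>H\<close> but not in \<open>H'\<close> and
  \<open>b\<close> in \<open>H'\<close> but not in \<open>H\<close>, the linear relation of the
  function that is 1 at \<open>a\<close> and -1 at \<open>b\<close>, multiplied by the monomial of
  \<open>C\<close>, reduces to the difference of the two flag monomials. Members of \<open>C\<close>
  contain both or neither of \<open>a\<close> and \<open>b\<close>; any third flat completing
  \<open>C\<close> contains neither, since covers of \<open>A\<close> are disjoint outside
  \<open>A\<close>; all other products are not chains.\<close>

lemma adjacent_flags_congruent:
  assumes C: "flag C" "H \<notin> C" "H' \<notin> C" "maxflag (insert H C)" "maxflag (insert H' C)"
  shows "single (sqfree (insert H C)) 1 - single (sqfree (insert H' C)) 1 \<in> I"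
proof (cases "H = H'")
  case True
  then show ?thesis by simp
next
  case False
  note finC = flag_finite[OF C(1)]
  have fl: "flag (insert H C)" "flag (insert H' C)" and card: "card (insert H C) = d"
    using C(4,5) by (auto simp: maxflag_iff)
  have HV: "H \<in> V" "H' \<in> V" using fl[THEN flag_mem_V] by auto
  have corank: "card C + 1 = d" using card C(2) finC by simp
  obtain A B where AB: "A \<in> flats E indep"
    and iff: "\<And>H. H \<in> V \<Longrightarrow> H \<notin> C \<and> flag (insert H C) \<longleftrightarrow> A \<subseteq> H \<and> H \<subseteq> B \<and> rk H = Suc (rk A)"
    by (rule corank_one_flag[OF C(1) corank], rule that, assumption+)
  have H: "A \<subseteq> H" "rk H = Suc (rk A)" and H': "A \<subseteq> H'" "rk H' = Suc (rk A)"
    using iff[OF HV(1)] iff[OF HV(2)] C(2,3) fl by blast+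
  have "\<not> H \<subseteq> H'" "\<not> H' \<subseteq> H"
    using flat_eqI[OF V_flat[OF HV(1)] V_flat[OF HV(2)]] flat_eqI[OF V_flat[OF HV(2)] V_flat[OF HV(1)]]
      H(2) H'(2) False by auto
  then obtain a b where a: "a \<in> H" "a \<notin> H'" and b: "b \<in> H'" "b \<notin> H" by blast
  have aA: "a \<notin> A" "b \<notin> A" using a b H H' by blast+
  define c :: "'a \<Rightarrow> real" where "c x = (if x = a then 1 else 0) - (if x = b then 1 else 0)" for x
  have sum_c: "sum c F = (if a \<in> F then 1 else 0) - (if b \<in> F then 1 else 0)" if "finite F" for F
    using that by (simp add: c_def sum_subtractf)
  have abE: "a \<in> E" "b \<in> E"
    using a b flat_subset_ground[OF V_flat[OF HV(1)]] flat_subset_ground[OF V_flat[OF HV(2)]] by blast+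
  have cE: "sum c E = 0" using abE finite_ground by (simp add: sum_c)
  have CV: "C \<subseteq> V" using flag_mem_V[OF C(1)] by blast
  have other: "single (sqfree C + single K 1) (sum c K) \<in> I" if K: "K \<in> V" "K \<noteq> H" "K \<noteq> H'" for K
  proof (cases "K \<in> C")
    case True
    have le: "K \<subseteq> H \<longleftrightarrow> rk K \<le> rk H" "H \<subseteq> K \<longleftrightarrow> rk H \<le> rk K"
      by (rule iffI[OF rk_mono flag_le[OF fl(1)]]; use True in simp)+
    have le': "K \<subseteq> H' \<longleftrightarrow> rk K \<le> rk H'" "H' \<subseteq> K \<longleftrightarrow> rk H' \<le> rk K"
      by (rule iffI[OF rk_mono flag_le[OF fl(2)]]; use True in simp)+
    \<comment> \<open>\<open>H\<close> and \<open>H'\<close> have the same rank, so a member of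
      \<open>C\<close> lies below both or above both. Below both it contains neither element, above
      both it contains the two.\<close>
    have "a \<in> K \<longleftrightarrow> b \<in> K"
    proof (cases "rk K \<le> rk H")
      case True
      then show ?thesis using le(1) le'(1) H(2) H'(2) a b by auto
    next
      case False
      then show ?thesis using le(2) le'(2) H(2) H'(2) a b by auto
    qed
    then show ?thesis using sum_c[OF finite_V_mem[OF K(1)]] by simp
  next
    case nC: False
    show ?thesis
    proof (cases "flag (insert K C)")
      case True
      then have KA: "A \<subseteq> K" "rk K = Suc (rk A)" using iff[OF K(1)] nC by blast+
      have "a \<notin> K"
        using cover_unique[OF AB V_flat[OF K(1)] KA, of a] cover_unique[OF AB V_flat[OF HV(1)] H, of a]
          a aA K(2) by blast
      moreover have "b \<notin> K"
        using cover_unique[OF AB V_flat[OF K(1)] KA, of b] cover_unique[OF AB V_flat[OF HV(2)] H', of b]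
          b aA K(3) by blast
      ultimately show ?thesis using sum_c[OF finite_V_mem[OF K(1)]] by simp
    next
      case False
      have "keys (sqfree C + single K (1::nat)) = insert K C"
        using finC by (simp add: keys_add_nat)
      then show ?thesis using False K(1) CV by (intro nonflag_in_I) simp_all
    qed
  qed
  have mons: "sqfree C + single H 1 = sqfree (insert H C)" "sqfree C + single H' 1 = sqfree (insert H' C)"
    using sqfree_insert[OF finC] C(2,3) by auto
  have cH: "sum c H = 1" "sum c H' = - 1"
    using sum_c[OF finite_V_mem[OF HV(1)]] sum_c[OF finite_V_mem[OF HV(2)]] a b by auto
  define f where "f K = single (sqfree C + single K 1) (sum c K)" for K
  have total: "sum f V \<in> I"
    unfolding f_def by (rule linear_in_I[OF cE]) (use CV finC in simp)
  have split: "sum f V = f H + (f H' + sum f (V - {H} - {H'}))"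
    using HV False finite_V by (simp add: sum.remove)
  have rest: "sum f (V - {H} - {H'}) \<in> I"
    using other by (intro I_sum) (auto simp: f_def)
  have "single (sqfree (insert H C)) 1 - single (sqfree (insert H' C)) 1 = f H + f H'"
    unfolding f_def cH mons by (simp add: single_uminus)
  also have "\<dots> = sum f V - sum f (V - {H} - {H'})" using split by simp
  finally show ?thesis using I_diff[OF total rest] by simp
qed

lemma maxflags_congruent:
  assumes "maxflag S" "maxflag S'"
  shows "single (sqfree S) 1 - single (sqfree S') 1 \<in> I"
proof (rule maxflag_connected[where P = "\<lambda>T. single (sqfree S) 1 - single (sqfree T) 1 \<in> I", OF _ assms])
  show "single (sqfree S) 1 - single (sqfree S) 1 \<in> I" by simp
next
  fix C H H'
  assume C: "flag C" "H \<notin> C" "H' \<notin> C" "maxflag (insert H C)" "maxflag (insert H' C)"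
    and eq: "single (sqfree S) 1 - single (sqfree (insert H C)) 1 \<in> I"
  from I_add[OF eq adjacent_flags_congruent[OF C]]
  show "single (sqfree S) 1 - single (sqfree (insert H' C)) 1 \<in> I" by simp
qed

end

section \<open>The functional defined by the determinantal sum\<close>

locale general_configuration = loopless_matroid +
  fixes v :: "'a \<Rightarrow> real vec"
  assumes d_pos: "d \<ge> 1"
    and general: "general_vectors E indep d v"
begin

text \<open>The numbers \<open>a_F\<close> indexed by flats instead of positions, so that sums and
  products can run over the set of flats of a chain.\<close>

definition coef :: "'a set list \<Rightarrow> 'a set \<Rightarrow> real" where
  "coef Fs F = lookup (det (hat_matrix d v Fs)) (single F 1)"

text \<open>The pullback of the linear function with coordinates \<open>w\<close> along the linear
  map that sends the basis vector of \<open>x\<close> to \<open>v x\<close>. Its sum over a flat is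
  its value on the ray of that flat.\<close>

definition vform :: "(nat \<Rightarrow> real) \<Rightarrow> 'a \<Rightarrow> real" where
  "vform w x = (\<Sum>r<d-1. w r * v x $ r)"

lemma vform_sum:
  assumes "F \<subseteq> E"
  shows "sum (vform w) F = (\<Sum>r<d-1. w r * vec_sum (d - 1) v F $ r)"
proof -
  have "finite F" using assms finite_ground by (rule finite_subset)
  moreover have "v i \<in> carrier_vec (d - 1)" if "i \<in> F" for i
    using that assms general by (auto simp: general_vectors_def)
  ultimately have "vec_sum (d - 1) v F $ r = (\<Sum>i\<in>F. v i $ r)" if "r < d - 1" for r
    using that by (intro vec_sum_index) auto
  then have "(\<Sum>r<d-1. w r * vec_sum (d - 1) v F $ r) = (\<Sum>r<d-1. \<Sum>i\<in>F. w r * v i $ r)"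
    by (intro sum.cong) (auto simp: sum_distrib_left)
  also have "\<dots> = sum (vform w) F"
    unfolding vform_def by (rule sum.swap)
  finally show ?thesis by simp
qed

lemma vform_ground: "sum (vform w) E = 0"
proof -
  have "vec_sum (d - 1) v E = 0\<^sub>v (d - 1)" using general by (simp add: general_vectors_def)
  then show ?thesis by (simp add: vform_sum)
qed

lemma MC_bij: "Fs \<in> MC \<Longrightarrow> bij_betw ((!) Fs) {..<d} (set Fs)"
  by (rule bij_betw_nth) (auto simp: MC_distinct MC_length)

lemma coef_nth: "Fs \<in> MC \<Longrightarrow> j < d \<Longrightarrow> coef Fs (Fs ! j) = ray_coeff d v Fs j"
  using chain_coeff_eq[OF d_pos MC_distinct MC_length] by (simp add: coef_def chain_coeff_def)

lemma det_eq:
  assumes "Fs \<in> MC"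
  shows "det (hat_matrix d v Fs) = (\<Sum>F\<in>set Fs. PConst (coef Fs F) * PVar F)"
  unfolding sum.reindex_bij_betw[OF MC_bij[OF assms], symmetric] det_hat_matrix[OF d_pos]
  by (rule sum.cong) (use assms in \<open>auto simp: coef_nth\<close>)

lemma chain_const_eq:
  assumes "Fs \<in> MC"
  shows "chain_const d v Fs = fact d * (\<Prod>F\<in>set Fs. coef Fs F)"
  unfolding prod.reindex_bij_betw[OF MC_bij[OF assms], symmetric] chain_const_def
  by (simp add: coef_def chain_coeff_def)

text \<open>The form in which genericity is used: it permits division by \<open>a_F\<close> and
  makes any \<open>d - 1\<close> of the vectors of a maximal chain a basis.\<close>

lemma coef_nonzero:
  assumes "Fs \<in> MC" "F \<in> set Fs"
  shows "coef Fs F \<noteq> 0"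
proof -
  have "chain_const d v Fs \<noteq> 0" using assms(1) general by (simp add: general_vectors_def)
  then show ?thesis using assms(2) by (simp add: chain_const_eq[OF assms(1)])
qed

lemma MC_ground: "Fs \<in> MC \<Longrightarrow> F \<in> set Fs \<Longrightarrow> F \<subseteq> E"
  using MC_subset V_flat flat_subset_ground by blast

lemma vform_relation:
  assumes "Fs \<in> MC"
  shows "(\<Sum>F\<in>set Fs. coef Fs F * sum (vform w) F) = 0"
proof -
  have "(\<Sum>F\<in>set Fs. coef Fs F * sum (vform w) F) =
      (\<Sum>F\<in>set Fs. \<Sum>r<d-1. w r * (coef Fs F * vec_sum (d - 1) v F $ r))"
    by (rule sum.cong)
      (use assms in \<open>auto simp: vform_sum MC_ground sum_distrib_left mult.left_commute\<close>)
  also have "\<dots> = (\<Sum>r<d-1. w r * (\<Sum>F\<in>set Fs. coef Fs F * vec_sum (d - 1) v F $ r))"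
    by (subst sum.swap) (simp add: sum_distrib_left)
  also have "\<dots> = 0"
  proof (rule sum.neutral, rule ballI)
    fix r assume r: "r \<in> {..<d-1}"
    have "(\<Sum>F\<in>set Fs. coef Fs F * vec_sum (d - 1) v F $ r) =
        (\<Sum>j<d. ray_coeff d v Fs j * vec_sum (d - 1) v (Fs ! j) $ r)"
      unfolding sum.reindex_bij_betw[OF MC_bij[OF assms], symmetric]
      by (rule sum.cong) (use assms in \<open>auto simp: coef_nth\<close>)
    then show "w r * (\<Sum>F\<in>set Fs. coef Fs F * vec_sum (d - 1) v F $ r) = 0"
      using ray_coeff_relation[of r d v Fs] r by simp
  qed
  finally show ?thesis .
qed

text \<open>The flag is completed to a maximal one, which contains some \<open>G0\<close> outside
  \<open>C\<close>. As \<open>a_G0\<close> is nonzero, the vectors of the remaining flats form a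
  basis, and a dual basis vector does the job. On a maximal flag no such form exists, because
  \<open>vform_relation\<close> would force \<open>a_G\<close> to be 0.\<close>

lemma vform_dual:
  assumes "flag C" "card C < d" "G \<in> C"
  obtains w where "sum (vform w) G = 1" "\<And>F. F \<in> C \<Longrightarrow> F \<noteq> G \<Longrightarrow> sum (vform w) F = 0"
proof -
  obtain M where M: "maxflag M" "C \<subseteq> M" by (rule flag_extend[OF assms(1)])
  obtain Fs where Fs: "Fs \<in> MC" "set Fs = M" by (rule MC_obtain[OF M(1)])
  have "card M = d" using M(1) by (simp add: maxflag_iff)
  then have "M \<noteq> C" using assms(2) by auto
  then obtain G0 where G0: "G0 \<in> M" "G0 \<notin> C" using M(2) by blast
  have ex: "\<exists>j<d. Fs ! j = F" if "F \<in> M" for F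
    using that Fs MC_length by (metis in_set_conv_nth)
  obtain j0 where j0: "j0 < d" "Fs ! j0 = G0" using ex[OF G0(1)] by blast
  obtain j1 where j1: "j1 < d" "Fs ! j1 = G" using ex[of G] assms(3) M(2) by blast
  have "ray_coeff d v Fs j0 \<noteq> 0"
    using coef_nonzero[OF Fs(1), of G0] coef_nth[OF Fs(1) j0(1)] j0(2) G0(1) Fs(2) by simp
  moreover have "j1 \<noteq> j0" using j0 j1 G0(2) assms(3) by blast
  ultimately obtain w where w: "(\<Sum>r<d-1. w r * vec_sum (d - 1) v (Fs ! j1) $ r) = 1"
    "\<And>j. j < d \<Longrightarrow> j \<noteq> j0 \<Longrightarrow> j \<noteq> j1 \<Longrightarrow> (\<Sum>r<d-1. w r * vec_sum (d - 1) v (Fs ! j) $ r) = 0"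
    using ray_coeff_dual[of d v Fs j0 j1] j0(1) j1(1) by metis
  show thesis
  proof (rule that[of w])
    show "sum (vform w) G = 1"
      using w(1) vform_sum[of G w] MC_ground[OF Fs(1)] Fs(2) M(2) assms(3) j1(2) by auto
    show "sum (vform w) F = 0" if F: "F \<in> C" "F \<noteq> G" for F
    proof -
      obtain j where j: "j < d" "Fs ! j = F" using ex[of F] F(1) M(2) by blast
      have "j \<noteq> j0" "j \<noteq> j1" using j(2) j0(2) j1(2) F G0(2) by blast+
      then show ?thesis
        using w(2)[OF j(1)] vform_sum[of F w] MC_ground[OF Fs(1)] Fs(2) M(2) F(1) j(2) by auto
    qed
  qed
qed

section \<open>The action of monomial operators on the determinantal sum\<close>

abbreviation D where "D \<equiv> determinantal_sum E indep d v"

lemma D_polys: "D \<in> polys_in V"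
  unfolding determinantal_sum_def
proof (intro polys_in_sum polys_in_mult polys_in_PConst polys_in_power)
  fix Fs assume Fs: "Fs \<in> MC"
  show "det (hat_matrix d v Fs) \<in> polys_in V"
    unfolding det_eq[OF Fs] using MC_subset[OF Fs]
    by (intro polys_in_sum polys_in_mult polys_in_PConst polys_in_PVar) auto
qed

lemma D_homogeneous: "homogeneous d D"
  unfolding determinantal_sum_def
proof (intro homogeneous_sum)
  fix Fs assume Fs: "Fs \<in> MC"
  have "homogeneous (0 + 1) (det (hat_matrix d v Fs))"
    unfolding det_eq[OF Fs]
    by (intro homogeneous_sum homogeneous_mult homogeneous_PConst homogeneous_PVar)
  then have "homogeneous (d * 1) (det (hat_matrix d v Fs) ^ d)"
    by (intro homogeneous_power) simp
  then have "homogeneous (0 + d * 1) (PConst (1 / chain_const d v Fs) * det (hat_matrix d v Fs) ^ d)"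
    by (intro homogeneous_mult homogeneous_PConst)
  then show "homogeneous d (PConst (1 / chain_const d v Fs) * det (hat_matrix d v Fs) ^ d)"
    by simp
qed

text \<open>The value at \<open>D\<close> of the differential operator given by the monomial \<open>m\<close>.\<close>

definition lam :: "('a set \<Rightarrow>\<^sub>0 nat) \<Rightarrow> real" where
  "lam m = mfact m * lookup D m"

lemma lam_degree: "mdeg m \<noteq> d \<Longrightarrow> lam m = 0"
  using homogeneous_lookup[OF D_homogeneous] by (simp add: lam_def)

text \<open>The factor \<open>d!\<close> of the power cancels against that of
  \<open>chain_const\<close>, whose other factors lower each exponent by one. The quotient stands in
  for the exponent \<open>m_F - 1\<close>, which is -1 at flats of the chain outside the support of
  \<open>m\<close>.\<close>

lemma lam_eq:
  assumes "mdeg m = d"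
  shows "lam m = (\<Sum>Fs\<in>MC. if keys m \<subseteq> set Fs
    then \<Prod>F\<in>set Fs. coef Fs F ^ lookup m F / coef Fs F else 0)"
proof -
  have "lam m = (\<Sum>Fs\<in>MC. 1 / chain_const d v Fs * (mfact m * lookup (det (hat_matrix d v Fs) ^ d) m))"
    unfolding lam_def determinantal_sum_def lookup_sum lookup_PConst_times sum_distrib_left
    by (simp add: mult.left_commute)
  also have "\<dots> = (\<Sum>Fs\<in>MC. if keys m \<subseteq> set Fs
    then \<Prod>F\<in>set Fs. coef Fs F ^ lookup m F / coef Fs F else 0)"
  proof (rule sum.cong[OF refl])
    fix Fs assume Fs: "Fs \<in> MC"
    show "1 / chain_const d v Fs * (mfact m * lookup (det (hat_matrix d v Fs) ^ d) m) =
      (if keys m \<subseteq> set Fs then \<Prod>F\<in>set Fs. coef Fs F ^ lookup m F / coef Fs F else 0)"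
      unfolding det_eq[OF Fs] lookup_linear_power[OF finite_set assms] chain_const_eq[OF Fs]
      by (simp add: prod_dividef)
  qed
  finally show ?thesis .
qed

lemma lam_nonflag:
  assumes "\<not> flag (keys m)"
  shows "lam m = 0"
proof (cases "mdeg m = d")
  case True
  have "\<not> keys m \<subseteq> set Fs" if "Fs \<in> MC" for Fs
    using that assms flag_subset by (auto simp: MC_iff maxflag_iff)
  then show ?thesis unfolding lam_eq[OF True] by (intro sum.neutral) simp
qed (rule lam_degree)

text \<open>A maximal flag is contained in no maximal flag but itself, so one summand survives, and
  there every exponent is 1 and every factor is \<open>a_F / a_F\<close>.\<close>

lemma lam_maxflag:
  assumes "maxflag S"
  shows "lam (sqfree S) = 1"
proof -
  have S: "flag S" "card S = d" using assms by (auto simp: maxflag_iff)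
  have fin: "finite S" by (rule flag_finite[OF S(1)])
  obtain Gs where Gs: "Gs \<in> MC" "set Gs = S" by (rule MC_obtain[OF assms])
  have "lam (sqfree S) = (\<Sum>Fs\<in>MC. if keys (sqfree S) \<subseteq> set Fs
      then \<Prod>F\<in>set Fs. coef Fs F ^ lookup (sqfree S) F / coef Fs F else 0)"
    using fin S(2) by (intro lam_eq) simp
  also have "\<dots> = (\<Sum>Fs\<in>MC. if Fs = Gs then 1 else 0)"
  proof (rule sum.cong[OF refl])
    fix Fs assume Fs: "Fs \<in> MC"
    have eq: "set Fs = S" if "S \<subseteq> set Fs"
      using card_subset_eq[OF finite_set that] S(2) Fs by (simp add: MC_iff maxflag_iff)
    show "(if keys (sqfree S) \<subseteq> set Fs
        then \<Prod>F\<in>set Fs. coef Fs F ^ lookup (sqfree S) F / coef Fs F else 0) = (if Fs = Gs then 1 else (0::real))"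
    proof (cases "S \<subseteq> set Fs")
      case True
      then have "Fs = Gs" using inj_onD[OF MC_inj _ Fs Gs(1)] eq Gs(2) by simp
      then show ?thesis
        using fin Gs coef_nonzero[OF Gs(1)] by (simp add: lookup_sqfree)
    next
      case False
      then show ?thesis using fin Gs(2) by auto
    qed
  qed
  also have "\<dots> = 1" using finite_MC Gs(1) by simp
  finally show ?thesis .
qed

text \<open>Multiplication of \<open>m\<close> by the variable of \<open>H\<close> multiplies the
  contribution of each chain through \<open>H\<close> by \<open>a_H\<close>. The relation between
  the vectors of a chain therefore makes the sum vanish separately for every chain.\<close>

lemma lam_vform:
  assumes "mdeg m + 1 = d"
  shows "(\<Sum>H\<in>V. sum (vform w) H * lam (m + single H 1)) = 0"
proof -
  define T where "T Fs = (\<Prod>F\<in>set Fs. coef Fs F ^ lookup m F / coef Fs F)" for Fs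
  have lam: "lam (m + single H 1) = (\<Sum>Fs\<in>MC. if keys m \<subseteq> set Fs \<and> H \<in> set Fs then T Fs * coef Fs H else 0)"
    for H
  proof -
    have "lam (m + single H 1) = (\<Sum>Fs\<in>MC. if keys (m + single H 1) \<subseteq> set Fs
        then \<Prod>F\<in>set Fs. coef Fs F ^ lookup (m + single H 1) F / coef Fs F else 0)"
      using assms by (intro lam_eq) (simp add: mdeg_add)
    also have "\<dots> = (\<Sum>Fs\<in>MC. if keys m \<subseteq> set Fs \<and> H \<in> set Fs then T Fs * coef Fs H else 0)"
    proof (rule sum.cong[OF refl])
      fix Fs
      have "(\<Prod>F\<in>set Fs. coef Fs F ^ lookup (m + single H 1) F / coef Fs F) = T Fs * coef Fs H"
        if H: "H \<in> set Fs"
      proof -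
        have "(\<Prod>F\<in>set Fs. coef Fs F ^ lookup (m + single H 1) F / coef Fs F) =
            coef Fs H ^ Suc (lookup m H) / coef Fs H *
            (\<Prod>F\<in>set Fs - {H}. coef Fs F ^ lookup m F / coef Fs F)"
        proof -
          have "lookup (m + single H 1) H = Suc (lookup m H)" by (simp add: lookup_add)
          moreover have "lookup (m + single H 1) F = lookup m F" if "F \<noteq> H" for F
            using that by (simp add: lookup_add lookup_single_not_eq)
          ultimately show ?thesis
            unfolding prod.remove[OF finite_set H] by simp
        qed
        then show ?thesis
          unfolding T_def prod.remove[OF finite_set H] by simp
      qed
      then show "(if keys (m + single H 1) \<subseteq> set Fs
          then \<Prod>F\<in>set Fs. coef Fs F ^ lookup (m + single H 1) F / coef Fs F else 0) =
        (if keys m \<subseteq> set Fs \<and> H \<in> set Fs then T Fs * coef Fs H else 0)"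
        by (simp add: keys_add_nat)
    qed
    finally show ?thesis .
  qed
  have "(\<Sum>H\<in>V. l H * lam (m + single H 1)) =
      (\<Sum>Fs\<in>MC. \<Sum>H\<in>V. if keys m \<subseteq> set Fs \<and> H \<in> set Fs
        then T Fs * (coef Fs H * l H) else 0)" for l
    unfolding lam sum_distrib_left by (subst sum.swap) (auto intro!: sum.cong)
  then have "(\<Sum>H\<in>V. sum (vform w) H * lam (m + single H 1)) =
      (\<Sum>Fs\<in>MC. \<Sum>H\<in>V. if keys m \<subseteq> set Fs \<and> H \<in> set Fs
        then T Fs * (coef Fs H * sum (vform w) H) else 0)" .
  also have "\<dots> = 0"
  proof (rule sum.neutral, rule ballI)
    fix Fs assume Fs: "Fs \<in> MC"
    have "(\<Sum>H\<in>V. if keys m \<subseteq> set Fs \<and> H \<in> set Fs then T Fs * (coef Fs H * sum (vform w) H) else 0) =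
        (\<Sum>H\<in>set Fs. if keys m \<subseteq> set Fs then T Fs * (coef Fs H * sum (vform w) H) else 0)"
      using MC_subset[OF Fs] finite_V by (intro sum.mono_neutral_cong_right) auto
    also have "\<dots> = 0"
      using vform_relation[OF Fs, of w]
      by (cases "keys m \<subseteq> set Fs") (simp_all flip: sum_distrib_left)
    finally show "(\<Sum>H\<in>V. if keys m \<subseteq> set Fs \<and> H \<in> set Fs
        then T Fs * (coef Fs H * sum (vform w) H) else 0) = 0" .
  qed
  finally show ?thesis .
qed

lemma keys_add_single: "keys (m + single H (1::nat)) = insert H (keys m)"
  by (simp add: keys_add_nat)

text \<open>A square in a monomial is removed by a linear form \<open>vform w\<close> that is 1 at one flat of the
  support and 0 at the others; this enlarges the support, and \<open>lam\<close> kills \<open>vform w\<close>. For a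
  squarefree monomial the linear form can be made to vanish on the support, where the balancing
  condition applies.\<close>

lemma lam_linear:
  assumes "mdeg m + 1 = d" "sum c E = 0"
  shows "(\<Sum>H\<in>V. sum c H * lam (m + single H 1)) = 0"
  using assms(1)
proof (induction "d - card (keys m)" arbitrary: m rule: less_induct)
  case less
  let ?C = "keys m"
  show ?case
  proof (cases "flag ?C")
    case False
    have "lam (m + single H 1) = 0" for H
    proof (rule lam_nonflag)
      show "\<not> flag (keys (m + single H 1))"
        using False flag_subset[of "keys (m + single H 1)" ?C] unfolding keys_add_single by blast
    qed
    then show ?thesis by simp
  next
    case C: True
    have CV: "?C \<subseteq> V" using flag_mem_V[OF C] by blast
    show ?thesis
    proof (cases "card ?C < mdeg m")
      case True
      then obtain G m' where G: "G \<in> keys m'" and m: "m = m' + single G 1"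
        by (rule squarefree_or_square)
      have Cm': "?C = keys m'" using G unfolding m keys_add_single by (rule insert_absorb)
      obtain w where w: "sum (vform w) G = 1" "\<And>F. F \<in> ?C \<Longrightarrow> F \<noteq> G \<Longrightarrow> sum (vform w) F = 0"
        by (rule vform_dual[OF C, of G]) (use True less.prems G Cm' in auto)
      have GV: "G \<in> V" using G CV Cm' by blast
      have deg: "mdeg (m' + single H 1) + 1 = d" for H
        using less.prems unfolding m mdeg_add mdeg_single .
      \<comment> \<open>The special form is applied to \<open>m'\<close> times \<open>H\<close>: its
        terms at flats of the support other than \<open>G\<close> vanish, and its term at
        \<open>G\<close> is the value wanted.\<close>
      have step: "lam (m + single H 1) =
          - (\<Sum>K\<in>V - ?C. sum (vform w) K * lam (m' + single K 1 + single H 1))" for H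
      proof -
        let ?f = "\<lambda>K. sum (vform w) K * lam (m' + single K 1 + single H 1)"
        have comm: "m' + single K 1 + single H 1 = m' + single H 1 + single K (1::nat)" for K
          by (simp add: ac_simps)
        have "0 = sum ?f V"
          using lam_vform[OF deg[of H], of w] unfolding comm by simp
        also have "\<dots> = sum ?f (insert G (V - ?C))"
          using finite_V GV w(2) CV by (intro sum.mono_neutral_right) auto
        also have "\<dots> = ?f G + sum ?f (V - ?C)"
          using finite_V G Cm' by (intro sum.insert) auto
        also have "?f G = lam (m + single H 1)" using w(1) m by simp
        finally show ?thesis by simp
      qed
      \<comment> \<open>The monomial \<open>m'\<close> times \<open>K\<close> has the degree of
        \<open>m\<close> but one more flat in its support, so the induction hypothesis
        applies.\<close>
      have inner: "(\<Sum>H\<in>V. sum c H * lam (m' + single K 1 + single H 1)) = 0" if K: "K \<in> V - ?C" for K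
      proof (rule less.hyps)
        have "keys (m' + single K 1) = insert K ?C" unfolding keys_add_single Cm' ..
        then have "card (keys (m' + single K 1)) = Suc (card ?C)" using K by simp
        then show "d - card (keys (m' + single K 1)) < d - card ?C"
          using True less.prems by linarith
      qed (rule deg)
      have "(\<Sum>H\<in>V. sum c H * lam (m + single H 1)) =
          - (\<Sum>H\<in>V. \<Sum>K\<in>V - ?C. sum (vform w) K * (sum c H * lam (m' + single K 1 + single H 1)))"
        unfolding step by (simp add: sum_distrib_left sum_negf mult.left_commute)
      also have "\<dots> = - (\<Sum>K\<in>V - ?C. sum (vform w) K *
          (\<Sum>H\<in>V. sum c H * lam (m' + single K 1 + single H 1)))"
        by (subst sum.swap) (simp add: sum_distrib_left)
      also have "\<dots> = 0" using inner by simp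
      finally show ?thesis .
    next
      case False
      then have card: "card ?C = mdeg m" using card_keys_le_mdeg[of m] by simp
      then have cardC: "card ?C + 1 = d" using less.prems by simp
      have mmon: "m = sqfree ?C" using card by (rule squarefree_if_card_eq)
      have "\<exists>w. sum (vform w) G = 1 \<and> (\<forall>F\<in>?C. F \<noteq> G \<longrightarrow> sum (vform w) F = 0)" if "G \<in> ?C" for G
        by (rule vform_dual[OF C _ that]) (use cardC in auto)
      then obtain w where w: "\<And>G. G \<in> ?C \<Longrightarrow> sum (vform (w G)) G = 1"
        "\<And>G F. G \<in> ?C \<Longrightarrow> F \<in> ?C \<Longrightarrow> F \<noteq> G \<Longrightarrow> sum (vform (w G)) F = 0"
        by metis
      \<comment> \<open>The dual special forms are combined so as to agree with \<open>c\<close> on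
        every flat of the support; the difference vanishes there and still sums to zero over
        \<open>E\<close>.\<close>
      define c' where "c' x = c x - (\<Sum>G\<in>?C. sum c G * vform (w G) x)" for x
      have sum_c': "sum c' F = sum c F - (\<Sum>G\<in>?C. sum c G * sum (vform (w G)) F)" for F
        unfolding c'_def sum_subtractf by (subst sum.swap) (simp add: sum_distrib_left)
      have c'E: "sum c' E = 0" unfolding sum_c' using assms(2) by (simp add: vform_ground)
      have c'C: "sum c' F = 0" if F: "F \<in> ?C" for F
      proof -
        have "(\<Sum>G\<in>?C. sum c G * sum (vform (w G)) F) = (\<Sum>G\<in>?C. if G = F then sum c G else 0)"
          by (rule sum.cong[OF refl]) (use w F in fastforce)
        then show ?thesis unfolding sum_c' using F by simp
      qed
      have "(\<Sum>H\<in>V. sum c H * lam (m + single H 1)) =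
          (\<Sum>H\<in>V. sum c' H * lam (m + single H 1)) +
          (\<Sum>H\<in>V. \<Sum>G\<in>?C. sum c G * (sum (vform (w G)) H * lam (m + single H 1)))"
        unfolding sum_c' sum.distrib[symmetric]
        by (rule sum.cong) (simp_all add: left_diff_distrib sum_distrib_right mult.assoc)
      also have "(\<Sum>H\<in>V. \<Sum>G\<in>?C. sum c G * (sum (vform (w G)) H * lam (m + single H 1))) =
          (\<Sum>G\<in>?C. sum c G * (\<Sum>H\<in>V. sum (vform (w G)) H * lam (m + single H 1)))"
        by (subst sum.swap) (simp add: sum_distrib_left)
      also have "\<dots> = 0" using lam_vform[OF less.prems] by simp
      \<comment> \<open>Flats of the support have coefficient 0, flats incomparable to a member of
        it have \<open>lam\<close> 0, and every other flat completes a maximal flag, where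
        \<open>lam\<close> is 1.\<close>
      also have "(\<Sum>H\<in>V. sum c' H * lam (m + single H 1)) =
          (\<Sum>H\<in>{H\<in>V. H \<notin> ?C \<and> flag (insert H ?C)}. sum c' H)"
      proof (rule sum.mono_neutral_cong_right[OF finite_V])
        show "\<forall>H\<in>V - {H \<in> V. H \<notin> ?C \<and> flag (insert H ?C)}. sum c' H * lam (m + single H 1) = 0"
          using c'C lam_nonflag unfolding keys_add_single[symmetric] by (auto simp: keys_add_single)
        show "sum c' H * lam (m + single H 1) = sum c' H"
          if H: "H \<in> {H \<in> V. H \<notin> ?C \<and> flag (insert H ?C)}" for H
        proof -
          have "card (insert H ?C) = d" using H cardC by simp
          then have "maxflag (insert H ?C)" using H by (simp add: maxflag_iff)
          moreover have "m + single H 1 = sqfree (insert H ?C)"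
            using H by (subst mmon) (simp add: sqfree_insert)
          ultimately show ?thesis by (simp add: lam_maxflag)
        qed
      qed blast
      also have "\<dots> = 0" by (rule corank_one_balanced[OF C cardC c'E c'C])
      finally show ?thesis by simp
    qed
  qed
qed

text \<open>The set \<open>K\<close> is the largest ideal on which the functional vanishes. Since it
  is defined by vanishing on all multiples, it is an ideal by construction, and only the monomial
  multiples of the generators have to be checked.\<close>

lemma linear_ext_lam_I:
  assumes "p \<in> I"
  shows "linear_ext lam p = 0"
proof -
  define K where "K = {q \<in> polys_in V. \<forall>r\<in>polys_in V. linear_ext lam (r * q) = 0}"
  have KI: "q \<in> K"
    if q: "q \<in> polys_in V" and zero: "\<And>m. linear_ext lam (single m 1 * q) = 0" for q
  proof -
    have "linear_ext lam (r * q) = 0" for r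
      unfolding linear_ext_times[of lam r] zero by simp
    then show ?thesis using q by (simp add: K_def)
  qed
  have K: "ideal K R"
  proof (rule idealI[OF R_ring])
    show "subgroup K (add_monoid R)"
    proof (rule group.subgroupI)
      show "group (add_monoid R)"
        using abelian_group.a_group[OF ring.is_abelian_group[OF R_ring]] .
      show "K \<subseteq> carrier (add_monoid R)" by (auto simp: K_def)
      show "K \<noteq> {}" by (auto simp: K_def intro!: exI[of _ 0])
    next
      fix a assume "a \<in> K"
      then have "\<ominus>\<^bsub>R\<^esub> a \<in> K"
        by (auto simp: K_def linear_ext_uminus)
      then show "inv\<^bsub>add_monoid R\<^esub> a \<in> K" by (simp add: a_inv_def)
    next
      fix a b assume "a \<in> K" "b \<in> K"
      then show "a \<otimes>\<^bsub>add_monoid R\<^esub> b \<in> K"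
        by (auto simp: K_def linear_ext_add distrib_left)
    qed
  next
    fix a x assume a: "a \<in> K" and x: "x \<in> carrier R"
    then show "x \<otimes>\<^bsub>R\<^esub> a \<in> K"
      by (auto simp: K_def simp flip: mult.assoc)
    then show "a \<otimes>\<^bsub>R\<^esub> x \<in> K" by (simp add: mult.commute)
  qed
  have "incomparable_gens E indep \<subseteq> K"
  proof
    fix q assume q: "q \<in> incomparable_gens E indep"
    then obtain F G where FG: "q = PVar F * PVar G" "F \<in> V" "G \<in> V" "\<not> F \<subseteq> G" "\<not> G \<subseteq> F"
      by (auto simp: incomparable_gens_def)
    show "q \<in> K"
    proof (rule KI)
      fix m :: "'a set \<Rightarrow>\<^sub>0 nat"
      have "\<not> flag (keys (m + single F 1 + single G 1))"
        unfolding keys_add_single subset_chain_def using FG(4,5) by blast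
      then have "lam (m + single F 1 + single G 1) = 0" by (rule lam_nonflag)
      then show "linear_ext lam (single m 1 * q) = 0"
        by (simp add: FG(1) PVar_def mult_single add.assoc)
    qed (use FG in simp)
  qed
  moreover have "linear_gens E indep \<subseteq> K"
  proof
    fix q assume q: "q \<in> linear_gens E indep"
    then obtain c where c: "q = (\<Sum>F\<in>V. PConst (sum c F) * PVar F)" "sum c E = 0"
      by (auto simp: linear_gens_def)
    show "q \<in> K"
    proof (rule KI)
      show "q \<in> polys_in V" using q gens_subset(2) by blast
      fix m
      have "linear_ext lam (single m 1 * q) = (\<Sum>H\<in>V. sum c H * lam (m + single H 1))"
        unfolding c(1) monomial_times_linear by (simp add: linear_ext_sum)
      also have "\<dots> = 0"
      proof (cases "mdeg m + 1 = d")
        case True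
        then show ?thesis by (rule lam_linear[OF _ c(2)])
      next
        case False
        then show ?thesis by (intro sum.neutral ballI) (simp add: lam_degree)
      qed
      finally show "linear_ext lam (single m 1 * q) = 0" .
    qed
  qed
  ultimately have "p \<in> K" using I_minimal[OF K] assms by blast
  then have "linear_ext lam (1 * p) = 0" unfolding K_def using polys_in_1 by blast
  then show ?thesis by simp
qed

text \<open>The exchange of squares used for \<open>lam\<close> is carried out modulo the ideal. It
  ends at monomials that are zero in the Chow ring or belong to maximal flags, all of which are
  congruent. The scalar \<open>r\<close> is not tracked here.\<close>

lemma monomial_reduction:
  assumes "mdeg m = d" "keys m \<subseteq> V" "maxflag S"
  shows "\<exists>r. single m 1 - single (sqfree S) r \<in> I"
  using assms(1,2)
proof (induction "d - card (keys m)" arbitrary: m rule: less_induct)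
  case less
  let ?C = "keys m"
  show ?case
  proof (cases "flag ?C")
    case False
    then show ?thesis using nonflag_in_I[OF _ less.prems(2)] by (intro exI[of _ 0]) simp
  next
    case C: True
    show ?thesis
    proof (cases "card ?C < mdeg m")
      case False
      then have card: "card ?C = mdeg m" using card_keys_le_mdeg[of m] by simp
      then have "maxflag ?C" using C less.prems by (simp add: maxflag_iff)
      from maxflags_congruent[OF this assms(3)] show ?thesis
        unfolding squarefree_if_card_eq[OF card, symmetric] by blast
    next
      case True
      then obtain G m' where G: "G \<in> keys m'" and m: "m = m' + single G 1"
        by (rule squarefree_or_square)
      have Cm': "?C = keys m'" using G unfolding m keys_add_single by (rule insert_absorb)
      obtain w where w: "sum (vform w) G = 1" "\<And>F. F \<in> ?C \<Longrightarrow> F \<noteq> G \<Longrightarrow> sum (vform w) F = 0"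
        by (rule vform_dual[OF C, of G]) (use True less.prems G Cm' in auto)
      have GV: "G \<in> V" using G less.prems(2) Cm' by blast
      have "\<exists>r. single (m' + single K 1) 1 - single (sqfree S) r \<in> I" if K: "K \<in> V - ?C" for K
      proof (rule less.hyps)
        have eq: "keys (m' + single K 1) = insert K ?C" unfolding keys_add_single Cm' ..
        then have "card (keys (m' + single K 1)) = Suc (card ?C)" using K by simp
        then show "d - card (keys (m' + single K 1)) < d - card ?C"
          using True less.prems(1) by linarith
        show "mdeg (m' + single K 1) = d"
          using less.prems(1) unfolding m mdeg_add mdeg_single .
        show "keys (m' + single K 1) \<subseteq> V" unfolding eq using less.prems(2) K by blast
      qed
      then obtain r where r: "\<And>K. K \<in> V - ?C \<Longrightarrow> single (m' + single K 1) 1 - single (sqfree S) (r K) \<in> I"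
        by metis
      let ?l = "\<lambda>K. sum (vform w) K"
      let ?f = "\<lambda>K. single (m' + single K 1) (?l K)"
      have "sum ?f V \<in> I"
        by (rule linear_in_I[OF vform_ground]) (use less.prems(2) Cm' in simp)
      moreover have "sum ?f V = sum ?f (insert G (V - ?C))"
        using finite_V GV w(2) less.prems(2) by (intro sum.mono_neutral_right) auto
      moreover have "\<dots> = single m 1 + sum ?f (V - ?C)"
        using finite_V G Cm' w(1) m by (subst sum.insert) auto
      ultimately have A: "single m 1 + sum ?f (V - ?C) \<in> I" by simp
      have B: "(\<Sum>K\<in>V - ?C. PConst (?l K) * (single (m' + single K 1) 1 - single (sqfree S) (r K))) \<in> I"
        by (intro I_sum I_mult r polys_in_PConst)
      have "(\<Sum>K\<in>V - ?C. PConst (?l K) * (single (m' + single K 1) 1 - single (sqfree S) (r K))) =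
          sum ?f (V - ?C) - single (sqfree S) (\<Sum>K\<in>V - ?C. ?l K * r K)"
        by (simp add: right_diff_distrib PConst_single sum_subtractf single_sum)
      then have "single m 1 - single (sqfree S) (- (\<Sum>K\<in>V - ?C. ?l K * r K)) \<in> I"
        using I_diff[OF A B] by (simp add: single_uminus)
      then show ?thesis by blast
    qed
  qed
qed

section \<open>The degree map\<close>

abbreviation cls where "cls \<equiv> chow_class E indep"
abbreviation Lam where "Lam \<equiv> linear_ext lam"

lemma cls_eq_iff:
  assumes "p \<in> polys_in V" "q \<in> polys_in V"
  shows "cls p = cls q \<longleftrightarrow> p - q \<in> I"
  using ring.quotient_eq_iff_same_a_r_cos[OF R_ring I_ideal, of p q] assms
  by (simp add: chow_class_def)

lemma cls_hom: "cls \<in> Ring.ring_hom R (chow_ring E indep)"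
  unfolding chow_class_def chow_ring_def by (rule ideal.rcos_ring_hom[OF I_ideal])

lemma cls_add:
  "p \<in> polys_in V \<Longrightarrow> q \<in> polys_in V \<Longrightarrow> cls p \<oplus>\<^bsub>chow_ring E indep\<^esub> cls q = cls (p + q)"
  using ring_hom_add[OF cls_hom, of p q] by simp

lemma cls_mult:
  "p \<in> polys_in V \<Longrightarrow> q \<in> polys_in V \<Longrightarrow> cls p \<otimes>\<^bsub>chow_ring E indep\<^esub> cls q = cls (p * q)"
  using ring_hom_mult[OF cls_hom, of p q] by simp

lemma flag_monomial:
  assumes "maxflag S"
  shows "single (sqfree S) r \<in> polys_in V" "homogeneous d (single (sqfree S) r)"
    "Lam (single (sqfree S) r) = r"
proof -
  have S: "flag S" "card S = d" using assms by (auto simp: maxflag_iff)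
  have "finite S" "S \<subseteq> V" using flag_finite[OF S(1)] flag_mem_V[OF S(1)] by blast+
  then show "single (sqfree S) r \<in> polys_in V" "homogeneous d (single (sqfree S) r)"
    using S(2) by simp_all
  show "Lam (single (sqfree S) r) = r" using lam_maxflag[OF assms] by simp
qed

text \<open>The scalars left open in the reduction of the monomials are determined together:
  \<open>Lam\<close> vanishes on the ideal and is 1 on the flag monomial, so their total must be
  \<open>Lam p\<close>.\<close>

lemma poly_reduction:
  assumes "p \<in> polys_in V" "homogeneous d p" "maxflag S"
  shows "p - single (sqfree S) (Lam p) \<in> I"
proof -
  have "\<exists>r. single m 1 - single (sqfree S) r \<in> I" if "m \<in> keys p" for m
    using that assms(1,2) by (intro monomial_reduction[OF _ _ assms(3)])
      (auto simp: homogeneous_iff polys_in_def)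
  then obtain r where r: "\<And>m. m \<in> keys p \<Longrightarrow> single m 1 - single (sqfree S) (r m) \<in> I"
    by metis
  have "(\<Sum>m\<in>keys p. PConst (lookup p m) * (single m 1 - single (sqfree S) (r m))) \<in> I"
    by (intro I_sum I_mult r polys_in_PConst)
  also have "(\<Sum>m\<in>keys p. PConst (lookup p m) * (single m 1 - single (sqfree S) (r m))) =
      (\<Sum>m\<in>keys p. single m (lookup p m)) - single (sqfree S) (\<Sum>m\<in>keys p. lookup p m * r m)"
    by (simp add: right_diff_distrib PConst_single sum_subtractf single_sum)
  also have "(\<Sum>m\<in>keys p. single m (lookup p m)) = p"
    by (rule poly_eq_sum_singles[symmetric]) simp_all
  finally have in_I: "p - single (sqfree S) (\<Sum>m\<in>keys p. lookup p m * r m) \<in> I" .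
  from linear_ext_lam_I[OF this] have "(\<Sum>m\<in>keys p. lookup p m * r m) = Lam p"
    using flag_monomial(3)[OF assms(3)] by (simp add: linear_ext_diff)
  with in_I show ?thesis by simp
qed

text \<open>The choice of the representative is immaterial because \<open>Lam\<close> vanishes on
  the ideal.\<close>

definition degree_map :: "'a set rpoly set \<Rightarrow> real" where
  "degree_map = restrict (\<lambda>X. Lam (SOME p. p \<in> polys_in V \<and> homogeneous d p \<and> X = cls p))
     (chow_graded E indep d)"

lemma gradedI: "p \<in> polys_in V \<Longrightarrow> homogeneous d p \<Longrightarrow> cls p \<in> chow_graded E indep d"
  by (simp add: chow_graded_def)

lemma gradedE:
  assumes "X \<in> chow_graded E indep d"
  obtains p where "p \<in> polys_in V" "homogeneous d p" "X = cls p"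
  using assms by (auto simp: chow_graded_def)

lemma degree_map_cls:
  assumes "p \<in> polys_in V" "homogeneous d p"
  shows "degree_map (cls p) = Lam p"
proof -
  define q where "q = (SOME q. q \<in> polys_in V \<and> homogeneous d q \<and> cls p = cls q)"
  have "q \<in> polys_in V \<and> homogeneous d q \<and> cls p = cls q"
    unfolding q_def by (rule someI[of _ p]) (use assms in simp)
  then have "p - q \<in> I" using cls_eq_iff[OF assms(1)] by blast
  then have "Lam p = Lam q" using linear_ext_lam_I[of "p - q"] by (simp add: linear_ext_diff)
  then show ?thesis using gradedI[OF assms] by (simp add: degree_map_def q_def)
qed

lemma maxflag_chain_monomial:
  assumes "Fs \<in> MC"
  shows "(\<Prod>F\<leftarrow>Fs. PVar F) = single (sqfree (set Fs)) 1" "maxflag (set Fs)"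
  using assms prod_list_PVar[OF MC_distinct[OF assms]] by (simp_all add: MC_iff)

lemma degree_map: "is_degree_map E indep d degree_map"
  unfolding is_degree_map_def
proof (intro conjI ballI allI)
  show "degree_map \<in> extensional (chow_graded E indep d)"
    unfolding degree_map_def by (rule restrict_extensional)
next
  fix X Y assume "X \<in> chow_graded E indep d" "Y \<in> chow_graded E indep d"
  then obtain p q where p: "p \<in> polys_in V" "homogeneous d p" "X = cls p"
    and q: "q \<in> polys_in V" "homogeneous d q" "Y = cls q" by (metis gradedE)
  show "degree_map (X \<oplus>\<^bsub>chow_ring E indep\<^esub> Y) = degree_map X + degree_map Y"
    using p q by (simp add: cls_add degree_map_cls homogeneous_add linear_ext_add)
next
  fix r X assume "X \<in> chow_graded E indep d"
  then obtain p where p: "p \<in> polys_in V" "homogeneous d p" "X = cls p" by (rule gradedE)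
  show "degree_map (cls (PConst r) \<otimes>\<^bsub>chow_ring E indep\<^esub> X) = r * degree_map X"
    using p by (simp add: cls_mult degree_map_cls homogeneous_scale linear_ext_PConst_times)
next
  obtain S where S: "maxflag S" by (rule ex_maxflag)
  show "bij_betw degree_map (chow_graded E indep d) UNIV"
    unfolding bij_betw_def
  proof (intro conjI inj_onI)
    fix X Y assume "X \<in> chow_graded E indep d" "Y \<in> chow_graded E indep d"
      and eq: "degree_map X = degree_map Y"
    then obtain p q where p: "p \<in> polys_in V" "homogeneous d p" "X = cls p"
      and q: "q \<in> polys_in V" "homogeneous d q" "Y = cls q" by (metis gradedE)
    \<comment> \<open>A polynomial with \<open>Lam\<close> equal to 0 is congruent to 0 times the
      flag monomial, so its class is zero.\<close>
    have "Lam (p - q) = 0" using p q eq by (simp add: degree_map_cls linear_ext_diff)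
    then have "p - q \<in> I"
      using poly_reduction[OF polys_in_diff[OF p(1) q(1)] homogeneous_diff[OF p(2) q(2)] S] by simp
    then show "X = Y" using cls_eq_iff p q by simp
  next
    have "r \<in> degree_map ` chow_graded E indep d" for r
      by (rule image_eqI[of _ _ "cls (single (sqfree S) r)"])
        (use flag_monomial[OF S] in \<open>auto simp: degree_map_cls intro: gradedI\<close>)
    then show "degree_map ` chow_graded E indep d = UNIV" by blast
  qed
next
  fix Fs assume "Fs \<in> MC"
  then show "degree_map (cls (\<Prod>F\<leftarrow>Fs. PVar F)) = 1"
    using flag_monomial[OF maxflag_chain_monomial(2), where r = 1]
    by (simp add: maxflag_chain_monomial(1) degree_map_cls)
qed

text \<open>Every class of degree \<open>d\<close> is a scalar multiple of the class of one maximal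
  chain, and there the value 1 is prescribed.\<close>

lemma degree_map_unique:
  assumes "is_degree_map E indep d g"
  shows "g = degree_map"
proof (rule extensionalityI[of _ "chow_graded E indep d"])
  show "g \<in> extensional (chow_graded E indep d)"
    using assms unfolding is_degree_map_def by blast
  show "degree_map \<in> extensional (chow_graded E indep d)"
    unfolding degree_map_def by (rule restrict_extensional)
next
  fix X assume X: "X \<in> chow_graded E indep d"
  then obtain p where p: "p \<in> polys_in V" "homogeneous d p" "X = cls p" by (rule gradedE)
  obtain S where "maxflag S" by (rule ex_maxflag)
  then obtain Fs where Fs: "Fs \<in> MC" by (rule MC_obtain)
  note mono = maxflag_chain_monomial[OF Fs]
  note fm = flag_monomial[OF mono(2)]
  have g1: "g (cls (single (sqfree (set Fs)) 1)) = 1"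
    using assms Fs mono(1) unfolding is_degree_map_def by metis
  have "X = cls (single (sqfree (set Fs)) (Lam p))"
    using poly_reduction[OF p(1,2) mono(2)] p cls_eq_iff fm(1) by simp
  also have "\<dots> = cls (PConst (Lam p)) \<otimes>\<^bsub>chow_ring E indep\<^esub> cls (single (sqfree (set Fs)) 1)"
    using fm(1) by (simp add: cls_mult PConst_single)
  finally have "g X = Lam p * g (cls (single (sqfree (set Fs)) 1))"
    using assms gradedI[OF fm(1,2)] unfolding is_degree_map_def by metis
  then show "g X = degree_map X" using g1 p by (simp add: degree_map_cls)
qed

lemma chow_deg_eq: "chow_deg E indep d = degree_map"
  unfolding chow_deg_def by (rule the_equality, rule degree_map, rule degree_map_unique)

section \<open>The mixed volume\<close>

lemma mixed_volume_D: "is_mixed_volume E indep d D"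
  unfolding is_mixed_volume_def chow_deg_eq
  using D_polys D_homogeneous apply_diff_homogeneous[OF D_homogeneous] degree_map_cls
  by (simp add: lam_def[abs_def])

text \<open>The operator of a monomial \<open>m\<close> of degree \<open>d\<close> returns the
  coefficient at \<open>m\<close> times the nonzero number \<open>mfact m\<close>, so the prescribed
  derivatives determine all coefficients at monomials in the flats; the others are zero.\<close>

lemma mixed_volume_unique:
  assumes "is_mixed_volume E indep d W"
  shows "W = D"
proof (rule homogeneous_eqI)
  show "homogeneous d W" using assms by (simp add: is_mixed_volume_def)
  show "homogeneous d D" by (rule D_homogeneous)
  fix m :: "'a set \<Rightarrow>\<^sub>0 nat" assume m: "mdeg m = d"
  show "lookup W m = lookup D m"
  proof (cases "keys m \<subseteq> V")
    case True
    then have f: "single m 1 \<in> polys_in V" "homogeneous d (single m 1)" using m by simp_all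
    have "apply_diff (single m 1) W = apply_diff (single m 1) D"
      using assms mixed_volume_D f unfolding is_mixed_volume_def by metis
    then have "(PConst (mfact m * lookup W m) :: 'a set rpoly) = PConst (mfact m * lookup D m)"
      using \<open>homogeneous d W\<close> D_homogeneous f(2) by (simp add: apply_diff_homogeneous)
    then show ?thesis by (simp add: PConst_inject)
  next
    case False
    then show ?thesis
      using assms D_polys unfolding is_mixed_volume_def polys_in_iff by metis
  qed
qed

lemma mixed_volume_eq: "mixed_volume E indep d = D"
  unfolding mixed_volume_def by (rule the_equality, rule mixed_volume_D, rule mixed_volume_unique)

end

theorem theorem1p2:
  fixes n d :: nat and indep :: "nat set \<Rightarrow> bool"
  assumes "matroid {1..n+1} indep"
    and "rank_of indep {1..n+1} = d + 1"
    and "d \<ge> 1"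
    and "{} \<in> flats {1..n+1} indep"
  shows "(\<forall>v :: nat \<Rightarrow> real vec. general_vectors {1..n+1} indep d v \<longrightarrow>
            mixed_volume {1..n+1} indep d = determinantal_sum {1..n+1} indep d v) \<and>
         (\<forall>v w :: nat \<Rightarrow> real vec.
            general_vectors {1..n+1} indep d v \<longrightarrow> general_vectors {1..n+1} indep d w \<longrightarrow>
            determinantal_sum {1..n+1} indep d v = determinantal_sum {1..n+1} indep d w)"
proof -
  have *: "mixed_volume {1..n+1} indep d = determinantal_sum {1..n+1} indep d v"
    if v: "general_vectors {1..n+1} indep d v" for v
  proof -
    interpret matroid "{1..n+1}" indep by (rule assms(1))
    interpret general_configuration "{1..n+1}" indep d v
      by unfold_locales (fact assms v)+
    show ?thesis by (rule mixed_volume_eq)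
  qed
  \<comment> \<open>Independence of the vectors follows because the mixed volume does not mention
    them.\<close>
  then show ?thesis by metis
qed

end
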